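(* Let $K:\mathbf R_{\ge 0}\to\mathcal D'(\mathbf R)$ be the heat kernel, given for a test function $\phi\in\mathcal D(\mathbf R)$ by $\langle K(t),\phi\rangle=\int_{-\infty}^{\infty}\frac{e^{-s^2/4t}}{\sqrt{4\pi t}}\,\phi(s)\,ds$ if $t>0$, and $\langle K(0),\phi\rangle=\phi(0)$. Then $K$ is smooth in the diffeological sense.
   Context: A diffeological space is a set $X$ with a collection of smooth plots $U\to X$ ($U$ ranging over open subsets of the spaces $\mathbf R^n$), stable under precomposition with smooth maps, local in $U$, and containing the constant maps. A map between diffeological spaces is smooth if it takes smooth plots to smooth plots by composition. $\mathbf R_{\ge 0}$ has the diffeology induced from $\mathbf R$: a map $U\to\mathbf R_{\ge 0}$ is a smooth plot iff it is smooth as a map into $\mathbf R$. Plots of a product are pairs of plots. $\mathcal D(\mathbf R)$ is the space of smooth functions $\mathbf R\to\mathbf R$ of compact support, with its standard (Schwartz, inductive limit) locally convex topology; a map $p:U\to\mathcal D(\mathbf R)$ is a smooth plot iff $T\circ p$ is smooth for every continuous linear functional $T$ on $\mathcal D(\mathbf R)$. $\mathcal D'(\mathbf R)$ is the vector space of distributions, i.e. continuous (equivalently, smooth) linear functionals $\mathcal D(\mathbf R)\to\mathbf R$; a map $U\to\mathcal D'(\mathbf R)$ is a smooth plot iff its transpose $U\times\mathcal D(\mathbf R)\to\mathbf R$ is smooth. *)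

theory Defs
  imports "HOL-Analysis.Analysis"
begin

section \<open>Smooth functions on open subsets of Euclidean spaces\<close>

text \<open>Plots are defined on open subsets of Euclidean spaces of all dimensions, so the dimension
  has to be a value. We use the library's \<^const>\<open>Euclidean_space\<close>, whose points are
  the sequences \<open>x\<close> with \<open>x i = 0\<close> for all \<open>i \<ge> n\<close>. Functions on a subset \<open>U\<close> are
  represented by functions on the whole type, of which only the values on \<open>U\<close> matter.\<close>

definition partial_deriv :: "nat \<Rightarrow> ((nat \<Rightarrow> real) \<Rightarrow> real) \<Rightarrow> (nat \<Rightarrow> real) \<Rightarrow> real" where
  "partial_deriv i f x = deriv (\<lambda>h. f (x(i := h))) (x i)"

primrec Ck_on :: "nat \<Rightarrow> nat \<Rightarrow> (nat \<Rightarrow> real) set \<Rightarrow> ((nat \<Rightarrow> real) \<Rightarrow> real) \<Rightarrow> bool" where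
  "Ck_on 0 n U f \<longleftrightarrow> continuous_on U f"
| "Ck_on (Suc k) n U f \<longleftrightarrow> continuous_on U f \<and>
     (\<forall>i<n. (\<forall>x\<in>U. (\<lambda>h. f (x(i := h))) differentiable (at (x i))) \<and>
            Ck_on k n U (partial_deriv i f))"

definition smooth_fun :: "nat \<Rightarrow> (nat \<Rightarrow> real) set \<Rightarrow> ((nat \<Rightarrow> real) \<Rightarrow> real) \<Rightarrow> bool" where
  "smooth_fun n U f \<longleftrightarrow> (\<forall>k. Ck_on k n U f)"

definition smooth_between ::
  "nat \<Rightarrow> (nat \<Rightarrow> real) set \<Rightarrow> nat \<Rightarrow> (nat \<Rightarrow> real) set \<Rightarrow> ((nat \<Rightarrow> real) \<Rightarrow> nat \<Rightarrow> real) \<Rightarrow> bool" where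
  "smooth_between m V n U f \<longleftrightarrow> f \<in> V \<rightarrow> U \<and> (\<forall>j<n. smooth_fun m V (\<lambda>x. f x j))"


section \<open>Diffeological spaces\<close>

record 'a diffeology =
  points :: "'a set"
  plots :: "nat \<Rightarrow> (nat \<Rightarrow> real) set \<Rightarrow> ((nat \<Rightarrow> real) \<Rightarrow> 'a) set"

locale diffeological_space =
  fixes X :: "'a diffeology"
  assumes plot_domain: "p \<in> plots X n U \<Longrightarrow> openin (Euclidean_space n) U"
    and plot_values: "p \<in> plots X n U \<Longrightarrow> p \<in> U \<rightarrow> points X"
    and plot_cong: "p \<in> plots X n U \<Longrightarrow> (\<And>x. x \<in> U \<Longrightarrow> q x = p x) \<Longrightarrow> q \<in> plots X n U"
    and plot_const: "openin (Euclidean_space n) U \<Longrightarrow> a \<in> points X \<Longrightarrow> (\<lambda>x. a) \<in> plots X n U"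
    and plot_precompose: "p \<in> plots X n U \<Longrightarrow> openin (Euclidean_space m) V \<Longrightarrow>
          smooth_between m V n U f \<Longrightarrow> p \<circ> f \<in> plots X m V"
    and plot_local: "openin (Euclidean_space n) U \<Longrightarrow>
          (\<And>x. x \<in> U \<Longrightarrow> \<exists>W. x \<in> W \<and> W \<subseteq> U \<and> openin (Euclidean_space n) W \<and> p \<in> plots X n W) \<Longrightarrow>
          p \<in> plots X n U"

definition smooth_map :: "'a diffeology \<Rightarrow> 'b diffeology \<Rightarrow> ('a \<Rightarrow> 'b) \<Rightarrow> bool" where
  "smooth_map X Y f \<longleftrightarrow> f \<in> points X \<rightarrow> points Y \<and>
     (\<forall>n U p. p \<in> plots X n U \<longrightarrow> f \<circ> p \<in> plots Y n U)"

definition real_space :: "real diffeology" where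
  "real_space = \<lparr>points = UNIV,
     plots = (\<lambda>n U. {p. openin (Euclidean_space n) U \<and> smooth_fun n U p})\<rparr>"

definition open_space :: "nat \<Rightarrow> (nat \<Rightarrow> real) set \<Rightarrow> (nat \<Rightarrow> real) diffeology" where
  "open_space n U = \<lparr>points = U,
     plots = (\<lambda>m V. {p. openin (Euclidean_space m) V \<and> smooth_between m V n U p})\<rparr>"

definition induced_space :: "'a diffeology \<Rightarrow> 'a set \<Rightarrow> 'a diffeology" where
  "induced_space X A = \<lparr>points = A, plots = (\<lambda>n U. {p \<in> plots X n U. p \<in> U \<rightarrow> A})\<rparr>"

definition product_space :: "'a diffeology \<Rightarrow> 'b diffeology \<Rightarrow> ('a \<times> 'b) diffeology" where
  "product_space X Y = \<lparr>points = points X \<times> points Y,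
     plots = (\<lambda>n U. {p. fst \<circ> p \<in> plots X n U \<and> snd \<circ> p \<in> plots Y n U})\<rparr>"

definition nonneg_space :: "real diffeology" where
  "nonneg_space = induced_space real_space {0..}"


section \<open>Test functions\<close>

definition test_function :: "(real \<Rightarrow> real) \<Rightarrow> bool" where
  "test_function f \<longleftrightarrow>
     (\<forall>k x. (deriv ^^ k) f differentiable (at x)) \<and> compact (closure {x. f x \<noteq> 0})"

lemma higher_deriv_zero: "(deriv ^^ k) (\<lambda>x::real. 0::real) = (\<lambda>x. 0)"
  by (induction k) auto

lemma higher_deriv_add:
  fixes f g :: "real \<Rightarrow> real"
  assumes "\<And>k x. (deriv ^^ k) f differentiable (at x)"
    and "\<And>k x. (deriv ^^ k) g differentiable (at x)"
  shows "(deriv ^^ k) (\<lambda>x. f x + g x) = (\<lambda>x. (deriv ^^ k) f x + (deriv ^^ k) g x)"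
proof (induction k)
  case (Suc k)
  have "deriv (\<lambda>x. (deriv ^^ k) f x + (deriv ^^ k) g x) x =
        deriv ((deriv ^^ k) f) x + deriv ((deriv ^^ k) g) x" for x
    using assms[of k x] by (intro deriv_add) (auto simp: field_differentiable_def
      real_differentiable_def)
  with Suc show ?case by auto
qed auto

lemma higher_deriv_cmult:
  fixes f :: "real \<Rightarrow> real"
  assumes "\<And>k x. (deriv ^^ k) f differentiable (at x)"
  shows "(deriv ^^ k) (\<lambda>x. c * f x) = (\<lambda>x. c * (deriv ^^ k) f x)"
proof (induction k)
  case (Suc k)
  have "deriv (\<lambda>x. c * (deriv ^^ k) f x) x = c * deriv ((deriv ^^ k) f) x" for x
    using assms[of k x] by (intro deriv_cmult) (auto simp: field_differentiable_def
      real_differentiable_def)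
  with Suc show ?case by auto
qed auto

lemma test_function_zero: "test_function (\<lambda>x. 0)"
  by (simp add: test_function_def higher_deriv_zero)

lemma test_function_add:
  assumes "test_function f" "test_function g"
  shows "test_function (\<lambda>x. f x + g x)"
proof -
  have "{x. f x + g x \<noteq> 0} \<subseteq> {x. f x \<noteq> 0} \<union> {x. g x \<noteq> 0}"
    by auto
  then show ?thesis
    using assms by (auto simp: test_function_def higher_deriv_add
      intro: bounded_subset[OF bounded_Un[THEN iffD2]])
qed

lemma test_function_cmult:
  assumes "test_function f"
  shows "test_function (\<lambda>x. c * f x)"
proof -
  have "{x. c * f x \<noteq> 0} \<subseteq> {x. f x \<noteq> 0}"
    by auto
  then show ?thesis
    using assms by (auto simp: test_function_def higher_deriv_cmult intro: bounded_subset)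
qed

typedef test_fun = "{f. test_function f}"
  morphisms tf_apply Abs_test_fun
  using test_function_zero by blast

setup_lifting type_definition_test_fun

instantiation test_fun :: real_vector
begin

lift_definition zero_test_fun :: test_fun is "\<lambda>x. 0"
  by (rule test_function_zero)

lift_definition plus_test_fun :: "test_fun \<Rightarrow> test_fun \<Rightarrow> test_fun" is "\<lambda>f g x. f x + g x"
  by (rule test_function_add)

lift_definition scaleR_test_fun :: "real \<Rightarrow> test_fun \<Rightarrow> test_fun" is "\<lambda>c f x. c * f x"
  by (rule test_function_cmult)

lift_definition uminus_test_fun :: "test_fun \<Rightarrow> test_fun" is "\<lambda>f x. - f x"
  using test_function_cmult[of _ "-1"] by simp

lift_definition minus_test_fun :: "test_fun \<Rightarrow> test_fun \<Rightarrow> test_fun" is "\<lambda>f g x. f x - g x"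
  using test_function_add test_function_cmult[of _ "-1"] by fastforce

instance
  by standard (transfer; simp add: algebra_simps)+

end

text \<open>The subspaces of test functions with support in a compact set \<open>K\<close> carry the topology of
  uniform convergence of all derivatives.\<close>

definition supported_in :: "real set \<Rightarrow> test_fun set" where
  "supported_in K = {\<phi>. closure {x. tf_apply \<phi> x \<noteq> 0} \<subseteq> K}"

definition open_in_supported :: "real set \<Rightarrow> test_fun set \<Rightarrow> bool" where
  "open_in_supported K G \<longleftrightarrow> G \<subseteq> supported_in K \<and>
     (\<forall>\<phi>\<in>G. \<exists>N. \<exists>\<epsilon>>0. \<forall>\<psi>\<in>supported_in K.
        (\<forall>k\<le>N. \<forall>x. \<bar>(deriv ^^ k) (tf_apply (\<psi> - \<phi>)) x\<bar> < \<epsilon>) \<longrightarrow> \<psi> \<in> G)"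

text \<open>The inductive limit topology: a base of neighbourhoods of \<open>0\<close> is given by the nonempty convex
  balanced sets whose trace on each of these subspaces is open (Rudin, Functional Analysis, 6.3).\<close>

definition basic_nhd :: "test_fun set \<Rightarrow> bool" where
  "basic_nhd W \<longleftrightarrow> W \<noteq> {} \<and> convex W \<and> (\<forall>c \<phi>. \<bar>c\<bar> \<le> 1 \<longrightarrow> \<phi> \<in> W \<longrightarrow> c *\<^sub>R \<phi> \<in> W) \<and>
     (\<forall>K. compact K \<longrightarrow> open_in_supported K (W \<inter> supported_in K))"

lemma open_in_supported_Int:
  assumes "open_in_supported K G" "open_in_supported K H"
  shows "open_in_supported K (G \<inter> H)"
  unfolding open_in_supported_def
proof (intro conjI ballI)
  show "G \<inter> H \<subseteq> supported_in K"
    using assms by (auto simp: open_in_supported_def)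
  fix \<phi> assume "\<phi> \<in> G \<inter> H"
  then obtain M d N e where d: "d > 0" "\<forall>\<psi>\<in>supported_in K.
        (\<forall>k\<le>M. \<forall>x. \<bar>(deriv ^^ k) (tf_apply (\<psi> - \<phi>)) x\<bar> < d) \<longrightarrow> \<psi> \<in> G"
      and e: "e > 0" "\<forall>\<psi>\<in>supported_in K.
        (\<forall>k\<le>N. \<forall>x. \<bar>(deriv ^^ k) (tf_apply (\<psi> - \<phi>)) x\<bar> < e) \<longrightarrow> \<psi> \<in> H"
    using assms unfolding open_in_supported_def by blast
  show "\<exists>N. \<exists>\<epsilon>>0. \<forall>\<psi>\<in>supported_in K.
        (\<forall>k\<le>N. \<forall>x. \<bar>(deriv ^^ k) (tf_apply (\<psi> - \<phi>)) x\<bar> < \<epsilon>) \<longrightarrow> \<psi> \<in> G \<inter> H"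
    using d e by (intro exI[of _ "max M N"] exI[of _ "min d e"]) auto
qed

lemma basic_nhd_zero: "basic_nhd W \<Longrightarrow> 0 \<in> W"
  unfolding basic_nhd_def by (metis abs_zero ex_in_conv scaleR_zero_left zero_le_one)

lemma basic_nhd_UNIV: "basic_nhd UNIV"
  unfolding basic_nhd_def open_in_supported_def using zero_less_one by blast

lemma basic_nhd_Int:
  assumes "basic_nhd W" "basic_nhd W'"
  shows "basic_nhd (W \<inter> W')"
proof -
  have "(W \<inter> W') \<inter> supported_in K = (W \<inter> supported_in K) \<inter> (W' \<inter> supported_in K)" for K
    by auto
  then show ?thesis
    using assms basic_nhd_zero[OF assms(1)] basic_nhd_zero[OF assms(2)]
    unfolding basic_nhd_def by (auto intro: convex_Int open_in_supported_Int)
qed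

instantiation test_fun :: topological_space
begin

definition open_test_fun :: "test_fun set \<Rightarrow> bool" where
  "open_test_fun G \<longleftrightarrow> (\<forall>\<phi>\<in>G. \<exists>W. basic_nhd W \<and> (\<lambda>\<psi>. \<phi> + \<psi>) ` W \<subseteq> G)"

instance
proof
  show "open (UNIV :: test_fun set)"
    unfolding open_test_fun_def using basic_nhd_UNIV by blast
  fix G H :: "test_fun set"
  assume "open G" "open H"
  show "open (G \<inter> H)"
    unfolding open_test_fun_def
  proof
    fix \<phi> assume "\<phi> \<in> G \<inter> H"
    then obtain W W' where "basic_nhd W" "(\<lambda>\<psi>. \<phi> + \<psi>) ` W \<subseteq> G" "basic_nhd W'" "(\<lambda>\<psi>. \<phi> + \<psi>) ` W' \<subseteq> H"
      using \<open>open G\<close> \<open>open H\<close> unfolding open_test_fun_def by (metis IntD1 IntD2)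
    then show "\<exists>W. basic_nhd W \<and> (\<lambda>\<psi>. \<phi> + \<psi>) ` W \<subseteq> G \<inter> H"
      by (intro exI[of _ "W \<inter> W'"]) (auto intro: basic_nhd_Int)
  qed
next
  fix \<G> :: "test_fun set set"
  assume "\<forall>G\<in>\<G>. open G"
  then show "open (\<Union>\<G>)"
    unfolding open_test_fun_def by (metis UnionE Union_upper subset_trans)
qed

end

definition distributions :: "(test_fun \<Rightarrow> real) set" where
  "distributions = {T. linear T \<and> continuous_on UNIV T}"

definition test_fun_space :: "test_fun diffeology" where
  "test_fun_space = \<lparr>points = UNIV,
     plots = (\<lambda>n U. {p. openin (Euclidean_space n) U \<and> (\<forall>T\<in>distributions. smooth_fun n U (T \<circ> p))})\<rparr>"

text \<open>A map into the distributions is a plot iff its transpose on \<open>U \<times> test_fun\<close> is smooth.\<close>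

definition distribution_space :: "(test_fun \<Rightarrow> real) diffeology" where
  "distribution_space = \<lparr>points = distributions,
     plots = (\<lambda>n U. {p. openin (Euclidean_space n) U \<and> p \<in> U \<rightarrow> distributions \<and>
       smooth_map (product_space (open_space n U) test_fun_space) real_space (\<lambda>(x, \<phi>). p x \<phi>)})\<rparr>"


section \<open>Properties of smooth functions\<close>

lemma openin_Euclidean_space_alt:
  "openin (Euclidean_space n) U \<longleftrightarrow> (\<exists>W. open W \<and> U = W \<inter> topspace (Euclidean_space n))"
  unfolding topspace_Euclidean_space
  unfolding Euclidean_space_def euclidean_product_topology [symmetric]
  by (auto simp: openin_subtopology euclidean_product_topology)

lemma Euclidean_space_box:
  assumes "openin (Euclidean_space n) U" "x \<in> U"
  obtains e where "e > 0"
    "\<And>y. y \<in> topspace (Euclidean_space n) \<Longrightarrow> (\<And>j. j < n \<Longrightarrow> \<bar>y j - x j\<bar> < e) \<Longrightarrow> y \<in> U"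
proof -
  obtain W where W: "open W" "U = W \<inter> topspace (Euclidean_space n)"
    using assms openin_Euclidean_space_alt by blast
  then have "openin (powertop_real UNIV) W" "x \<in> W"
    using assms by (auto simp: euclidean_product_topology)
  then obtain X where X: "x \<in> Pi\<^sub>E UNIV X" "\<And>i. open (X i)" "Pi\<^sub>E UNIV X \<subseteq> W"
    using product_topology_open_contains_basis[of "\<lambda>i. euclideanreal" UNIV W x]
    unfolding open_openin [symmetric] by blast
  have "\<forall>i. \<exists>d>0. ball (x i) d \<subseteq> X i"
    using X by (meson PiE_mem UNIV_I open_contains_ball)
  then obtain d where d: "\<And>i. d i > 0" "\<And>i. ball (x i) (d i) \<subseteq> X i"
    by metis
  define e where "e = Min (insert 1 (d ` {..<n}))"
  show ?thesis
  proof
    show "e > 0"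
      using d by (auto simp: e_def)
    fix y assume y: "y \<in> topspace (Euclidean_space n)" "\<And>j. j < n \<Longrightarrow> \<bar>y j - x j\<bar> < e"
    have "y j \<in> X j" for j
    proof (cases "j < n")
      case True
      then have "e \<le> d j"
        unfolding e_def by (intro Min_le) auto
      with y(2)[OF True] have "y j \<in> ball (x j) (d j)"
        by (auto simp: dist_real_def abs_minus_commute)
      then show ?thesis using d by blast
    next
      case False
      then have "y j = x j"
        using y(1) assms W by (auto simp: topspace_Euclidean_space)
      then show ?thesis
        using X by auto
    qed
    then have "y \<in> W" using X(3) by auto
    then show "y \<in> U" using W y by auto
  qed
qed

lemma continuous_on_box:
  assumes "openin (Euclidean_space n) U" "x \<in> U" "continuous_on U F" "\<epsilon> > (0::real)"
  obtains e where "e > 0"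
    "\<And>y. y \<in> topspace (Euclidean_space n) \<Longrightarrow> (\<And>j. j < n \<Longrightarrow> \<bar>y j - x j\<bar> < e) \<Longrightarrow>
       y \<in> U \<and> \<bar>F y - F x\<bar> < \<epsilon>"
proof -
  have "openin (top_of_set U) (U \<inter> F -` ball (F x) \<epsilon>)"
    using assms by (intro continuous_openin_preimage_gen) auto
  then obtain W where "open W" "U \<inter> F -` ball (F x) \<epsilon> = U \<inter> W"
    by (auto simp: openin_open)
  moreover obtain W' where "open W'" "U = W' \<inter> topspace (Euclidean_space n)"
    using assms openin_Euclidean_space_alt by blast
  ultimately have "openin (Euclidean_space n) (U \<inter> F -` ball (F x) \<epsilon>)"
    unfolding openin_Euclidean_space_alt by (intro exI[of _ "W \<inter> W'"]) auto
  then show ?thesis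
    using Euclidean_space_box[of n "U \<inter> F -` ball (F x) \<epsilon>" x] assms that
    by (auto simp: dist_real_def abs_minus_commute)
qed

lemma fun_upd_Euclidean_space:
  "x \<in> topspace (Euclidean_space n) \<Longrightarrow> i < n \<Longrightarrow> x(i := h) \<in> topspace (Euclidean_space n)"
  by (auto simp: topspace_Euclidean_space)

lemma openin_in_topspace:
  "openin (Euclidean_space n) U \<Longrightarrow> x \<in> U \<Longrightarrow> x \<in> topspace (Euclidean_space n)"
  using openin_subset by blast

lemma eventually_fun_upd:
  assumes "openin (Euclidean_space n) U" "x \<in> U" "i < n"
  shows "eventually (\<lambda>h. x(i := h) \<in> U) (nhds (x i))"
proof -
  obtain e where e: "e > 0"
    "\<And>y. y \<in> topspace (Euclidean_space n) \<Longrightarrow> (\<And>j. j < n \<Longrightarrow> \<bar>y j - x j\<bar> < e) \<Longrightarrow> y \<in> U"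
    using Euclidean_space_box assms(1,2) by blast
  have "x(i := h) \<in> U" if "dist h (x i) < e" for h
    using that e(1) fun_upd_Euclidean_space[OF openin_in_topspace[OF assms(1,2)] assms(3)]
    by (intro e(2)) (auto simp: dist_real_def)
  then show ?thesis
    using e(1) by (auto simp: eventually_nhds_metric)
qed

lemma DERIV_ev:
  assumes "(f has_real_derivative D) (at x)" "eventually (\<lambda>h. g h = f h) (nhds x)"
  shows "(g has_real_derivative D) (at x)"
  using DERIV_cong_ev[OF refl assms(2) refl] assms(1) by blast

lemma pd_deriv:
  "(\<lambda>h. f (x(i := h))) differentiable (at (x i)) \<longleftrightarrow>
     ((\<lambda>h. f (x(i := h))) has_real_derivative partial_deriv i f x) (at (x i))"
  unfolding partial_deriv_def using DERIV_imp_deriv real_differentiable_def by blast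

lemma pd_imp:
  "((\<lambda>h. f (x(i := h))) has_real_derivative D) (at (x i)) \<Longrightarrow>
    (\<lambda>h. f (x(i := h))) differentiable (at (x i)) \<and> partial_deriv i f x = D"
  unfolding partial_deriv_def using DERIV_imp_deriv real_differentiable_def by blast

lemma Ck_on_continuous: "Ck_on k n U f \<Longrightarrow> continuous_on U f"
  by (cases k) auto

lemma Ck_on_SucI:
  assumes "continuous_on U f"
    "\<And>i x. i < n \<Longrightarrow> x \<in> U \<Longrightarrow> ((\<lambda>h. f (x(i := h))) has_real_derivative D i x) (at (x i))"
    "\<And>i. i < n \<Longrightarrow> Ck_on k n U (partial_deriv i f)"
  shows "Ck_on (Suc k) n U f"
proof -
  have "(\<lambda>h. f (x(i := h))) differentiable (at (x i))" if "i < n" "x \<in> U" for i x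
    using pd_imp[of f x i "D i x"] assms(2)[OF that] by blast
  then show ?thesis
    using assms by simp
qed

lemma Ck_on_cong:
  assumes "openin (Euclidean_space n) U" "Ck_on k n U f" "\<And>x. x \<in> U \<Longrightarrow> g x = f x"
  shows "Ck_on k n U g"
  using assms(2,3)
proof (induction k arbitrary: f g)
  case 0
  then show ?case by (simp cong: continuous_on_cong)
next
  case (Suc k)
  have *: "((\<lambda>h. g (x(i := h))) has_real_derivative partial_deriv i f x) (at (x i))"
    if "x \<in> U" "i < n" for x i
  proof -
    have "eventually (\<lambda>h. g (x(i := h)) = f (x(i := h))) (nhds (x i))"
      using eventually_fun_upd[OF assms(1) that] by (rule eventually_mono) (simp add: Suc.prems del: fun_upd_apply)
    moreover have "((\<lambda>h. f (x(i := h))) has_real_derivative partial_deriv i f x) (at (x i))"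
      using Suc.prems that by (simp add: pd_deriv)
    ultimately show ?thesis
      by (rule DERIV_ev[rotated])
  qed
  then have "partial_deriv i g x = partial_deriv i f x" if "i < n" "x \<in> U" for i x
    using pd_imp[of g x i] that by blast
  then have "Ck_on k n U (partial_deriv i g)" if "i < n" for i
    using Suc.IH[of "partial_deriv i f" "partial_deriv i g"] Suc.prems that by auto
  moreover have "continuous_on U g"
    using Suc.prems by (simp cong: continuous_on_cong)
  ultimately show ?case
    using * by (intro Ck_on_SucI[where D = "\<lambda>i. partial_deriv i f"]) (auto simp del: fun_upd_apply)
qed

lemma Ck_on_SucI':
  assumes "openin (Euclidean_space n) U" "continuous_on U f"
    "\<And>i x. i < n \<Longrightarrow> x \<in> U \<Longrightarrow> ((\<lambda>h. f (x(i := h))) has_real_derivative D i x) (at (x i))"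
    "\<And>i. i < n \<Longrightarrow> Ck_on k n U (D i)"
  shows "Ck_on (Suc k) n U f"
proof (rule Ck_on_SucI)
  fix i assume i: "i < n"
  have "partial_deriv i f x = D i x" if "x \<in> U" for x
    using pd_imp[of f x i "D i x"] assms(3)[OF i that] by blast
  then show "Ck_on k n U (partial_deriv i f)"
    using Ck_on_cong assms(1,4) i by blast
qed (use assms in auto)

lemma Ck_on_subset: "Ck_on k n U f \<Longrightarrow> W \<subseteq> U \<Longrightarrow> Ck_on k n W f"
  by (induction k arbitrary: f) (auto intro: continuous_on_subset)

lemma Ck_on_Suc_imp: "Ck_on (Suc k) n U f \<Longrightarrow> Ck_on k n U f"
  by (induction k arbitrary: f) auto

lemma continuous_on_openin_local:
  assumes "openin (Euclidean_space n) U"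
    "\<And>x. x \<in> U \<Longrightarrow> \<exists>W. x \<in> W \<and> W \<subseteq> U \<and> openin (Euclidean_space n) W \<and> continuous_on W f"
  shows "continuous_on U (f :: _ \<Rightarrow> real)"
  unfolding continuous_on_eq_continuous_within
proof
  fix x assume "x \<in> U"
  then obtain W where W: "x \<in> W" "W \<subseteq> U" "openin (Euclidean_space n) W" "continuous_on W f"
    using assms(2) by blast
  then obtain S where S: "open S" "W = S \<inter> topspace (Euclidean_space n)"
    using openin_Euclidean_space_alt by blast
  have "U \<subseteq> topspace (Euclidean_space n)"
    using assms(1) openin_subset by blast
  then have "W = U \<inter> S"
    using W S by auto
  then have "at x within U = at x within W"
    using W S by (intro at_within_nhd[of x S]) auto
  then show "continuous (at x within U) f"
    using W by (auto simp: continuous_on_eq_continuous_within)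
qed

lemma Ck_on_local:
  assumes "openin (Euclidean_space n) U"
    "\<And>x. x \<in> U \<Longrightarrow> \<exists>W. x \<in> W \<and> W \<subseteq> U \<and> openin (Euclidean_space n) W \<and> Ck_on k n W f"
  shows "Ck_on k n U f"
  using assms(2)
proof (induction k arbitrary: f)
  case 0
  then show ?case using continuous_on_openin_local[OF assms(1)] by simp
next
  case (Suc k)
  have "continuous_on U f"
  proof (rule continuous_on_openin_local[OF assms(1)])
    show "\<exists>W. x \<in> W \<and> W \<subseteq> U \<and> openin (Euclidean_space n) W \<and> continuous_on W f" if "x \<in> U" for x
      using Suc.prems[OF that] Ck_on_continuous[of "Suc k" n _ f] by metis
  qed
  moreover have "Ck_on k n U (partial_deriv i f)" if "i < n" for i
  proof (rule Suc.IH)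
    show "\<exists>W. x \<in> W \<and> W \<subseteq> U \<and> openin (Euclidean_space n) W \<and> Ck_on k n W (partial_deriv i f)"
      if "x \<in> U" for x
      using Suc.prems[OF that] \<open>i < n\<close> by auto
  qed
  moreover have "(\<lambda>h. f (x(i := h))) differentiable (at (x i))" if "x \<in> U" "i < n" for x i
    using Suc.prems[OF that(1)] that(2) by (auto simp del: fun_upd_apply)
  ultimately show ?case by (simp del: fun_upd_apply)
qed

lemma Ck_on_const: "openin (Euclidean_space n) U \<Longrightarrow> Ck_on k n U (\<lambda>x. c)"
proof (induction k arbitrary: c)
  case (Suc k)
  then show ?case
    by (intro Ck_on_SucI'[where D = "\<lambda>i x. 0"]) auto
qed auto

lemma Ck_on_add:
  assumes "openin (Euclidean_space n) U"
  shows "Ck_on k n U f \<Longrightarrow> Ck_on k n U g \<Longrightarrow> Ck_on k n U (\<lambda>x. f x + g x)"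
proof (induction k arbitrary: f g)
  case (Suc k)
  then show ?case
    by (intro Ck_on_SucI'[where D = "\<lambda>i x. partial_deriv i f x + partial_deriv i g x"] assms)
       (auto simp: pd_deriv simp del: fun_upd_apply intro!: continuous_on_add DERIV_add)
qed (auto intro: continuous_intros)

lemma Ck_on_mult:
  assumes "openin (Euclidean_space n) U"
  shows "Ck_on k n U f \<Longrightarrow> Ck_on k n U g \<Longrightarrow> Ck_on k n U (\<lambda>x. f x * g x)"
proof (induction k arbitrary: f g)
  case (Suc k)
  have "((\<lambda>h. f (x(i := h)) * g (x(i := h))) has_real_derivative
       partial_deriv i f x * g x + partial_deriv i g x * f x) (at (x i))" if "i < n" "x \<in> U" for i x
    using that Suc.prems DERIV_mult[of "\<lambda>h. f (x(i := h))" "partial_deriv i f x" "x i" UNIV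
       "\<lambda>h. g (x(i := h))" "partial_deriv i g x"]
    by (auto simp: pd_deriv)
  moreover have "Ck_on k n U f" "Ck_on k n U g"
    using Suc.prems Ck_on_Suc_imp by blast+
  ultimately show ?case
    using Suc.prems
    by (intro Ck_on_SucI'[where D = "\<lambda>i x. partial_deriv i f x * g x + partial_deriv i g x * f x"] assms)
       (auto simp del: fun_upd_apply intro!: continuous_on_mult Ck_on_add[OF assms] Suc.IH)
qed (auto intro: continuous_intros)

lemma Ck_on_sum:
  fixes N :: nat
  assumes "openin (Euclidean_space n) U" "\<And>j. j < N \<Longrightarrow> Ck_on k n U (f j)"
  shows "Ck_on k n U (\<lambda>x. \<Sum>j<N. f j x)"
  using assms(2)
  by (induction N) (auto intro: Ck_on_const Ck_on_add assms(1))

lemma chain_step: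
  assumes U: "openin (Euclidean_space n) U" "a \<in> U" "j < n"
    and d: "\<And>x. x \<in> U \<Longrightarrow> (\<lambda>h. g (x(j := h))) differentiable (at (x j))"
    and cont: "continuous_on U (partial_deriv j g)"
    and z: "\<And>h. z h \<in> topspace (Euclidean_space n)"
    and c: "\<And>i. i < n \<Longrightarrow> ((\<lambda>h. z h i) \<longlongrightarrow> a i) (at t)"
    and b: "(b has_real_derivative b') (at t)" "b t = a j"
  shows "((\<lambda>h. (g ((z h)(j := b h)) - g ((z h)(j := a j))) / (h - t)) \<longlongrightarrow> partial_deriv j g a * b') (at t)"
proof -
  let ?F = "partial_deriv j g"
  have bt: "(b \<longlongrightarrow> a j) (at t)"
    using b DERIV_isCont isCont_def by metis
  have ev_box: "eventually (\<lambda>h. (\<forall>i<n. \<bar>z h i - a i\<bar> < e) \<and> \<bar>b h - a j\<bar> < e) (at t)" if "e > 0" for e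
  proof -
    have "eventually (\<lambda>h. \<forall>i\<in>{..<n}. \<bar>z h i - a i\<bar> < e) (at t)"
      using tendstoD[OF c that] by (auto simp: eventually_ball_finite_distrib dist_real_def)
    moreover have "eventually (\<lambda>h. \<bar>b h - a j\<bar> < e) (at t)"
      using tendstoD[OF bt that] by (auto simp: dist_real_def)
    ultimately show ?thesis by eventually_elim auto
  qed
  have in_box: "(z h)(j := \<xi>) \<in> topspace (Euclidean_space n) \<and> (\<forall>i<n. \<bar>((z h)(j := \<xi>)) i - a i\<bar> < e)"
    if "\<forall>i<n. \<bar>z h i - a i\<bar> < e" "\<bar>\<xi> - a j\<bar> < e" for h \<xi> e
    using that z U(3) by (auto intro: fun_upd_Euclidean_space)
  define P where "P h \<xi> \<longleftrightarrow> \<bar>\<xi> - a j\<bar> \<le> \<bar>b h - a j\<bar> \<and>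
      g ((z h)(j := b h)) - g ((z h)(j := a j)) = ?F ((z h)(j := \<xi>)) * (b h - a j)" for h \<xi>
  obtain e where e: "e > 0"
    "\<And>y. y \<in> topspace (Euclidean_space n) \<Longrightarrow> (\<And>j. j < n \<Longrightarrow> \<bar>y j - a j\<bar> < e) \<Longrightarrow> y \<in> U"
    using Euclidean_space_box U by blast
  have mvt: "\<exists>\<xi>. P h \<xi>" if h: "\<forall>i<n. \<bar>z h i - a i\<bar> < e" "\<bar>b h - a j\<bar> < e" for h
  proof -
    have D: "((\<lambda>u. g ((z h)(j := u))) has_real_derivative ?F ((z h)(j := u))) (at u)"
      if "\<bar>u - a j\<bar> \<le> \<bar>b h - a j\<bar>" for u
    proof -
      have "(z h)(j := u) \<in> U"
        using in_box[of h e u] h that e(2) by auto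
      from d[OF this] pd_deriv[of g "(z h)(j := u)" j] show ?thesis
        by simp
    qed
    consider "b h = a j" | "b h < a j" | "a j < b h" by linarith
    then show ?thesis
    proof cases
      case 1
      then show ?thesis by (intro exI[of _ "a j"]) (auto simp: P_def)
    next
      case 2
      then have "\<exists>\<xi>. b h < \<xi> \<and> \<xi> < a j \<and> g ((z h)(j := a j)) - g ((z h)(j := b h)) =
          (a j - b h) * ?F ((z h)(j := \<xi>))"
        by (intro MVT2 D) auto
      then obtain \<xi> where "b h < \<xi>" "\<xi> < a j" "g ((z h)(j := a j)) - g ((z h)(j := b h)) =
          (a j - b h) * ?F ((z h)(j := \<xi>))" by blast
      then show ?thesis by (intro exI[of _ \<xi>]) (auto simp: P_def algebra_simps)
    next
      case 3
      then have "\<exists>\<xi>. a j < \<xi> \<and> \<xi> < b h \<and> g ((z h)(j := b h)) - g ((z h)(j := a j)) =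
          (b h - a j) * ?F ((z h)(j := \<xi>))"
        by (intro MVT2 D) auto
      then obtain \<xi> where "a j < \<xi>" "\<xi> < b h" "g ((z h)(j := b h)) - g ((z h)(j := a j)) =
          (b h - a j) * ?F ((z h)(j := \<xi>))" by blast
      then show ?thesis by (intro exI[of _ \<xi>]) (auto simp: P_def algebra_simps)
    qed
  qed
  define \<xi> where "\<xi> h = (SOME u. P h u)" for h
  have evP: "eventually (\<lambda>h. P h (\<xi> h)) (at t)"
    using ev_box[OF e(1)] unfolding \<xi>_def by (rule eventually_mono) (use mvt in \<open>auto intro: someI_ex\<close>)
  have lim1: "((\<lambda>h. ?F ((z h)(j := \<xi> h))) \<longlongrightarrow> ?F a) (at t)"
  proof (rule tendstoI)
    fix \<epsilon> :: real assume "\<epsilon> > 0"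
    then obtain r where r: "r > 0"
      "\<And>y. y \<in> topspace (Euclidean_space n) \<Longrightarrow> (\<And>j. j < n \<Longrightarrow> \<bar>y j - a j\<bar> < r) \<Longrightarrow>
         y \<in> U \<and> \<bar>?F y - ?F a\<bar> < \<epsilon>"
      using continuous_on_box[OF U(1,2) cont] by metis
    show "eventually (\<lambda>h. dist (?F ((z h)(j := \<xi> h))) (?F a) < \<epsilon>) (at t)"
      using ev_box[OF r(1)] evP
    proof eventually_elim
      case (elim h)
      then have "\<bar>\<xi> h - a j\<bar> < r" by (auto simp: P_def)
      then show ?case
        using in_box[of h r "\<xi> h"] elim r(2) by (auto simp: dist_real_def)
    qed
  qed
  have lim2: "((\<lambda>h. (b h - a j) / (h - t)) \<longlongrightarrow> b') (at t)"
    using b by (auto simp: has_field_derivative_iff)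
  have "eventually (\<lambda>h. ?F ((z h)(j := \<xi> h)) * ((b h - a j) / (h - t)) =
      (g ((z h)(j := b h)) - g ((z h)(j := a j))) / (h - t)) (at t)"
    using evP by eventually_elim (auto simp: P_def)
  with tendsto_mult[OF lim1 lim2] show ?thesis
    by (rule Lim_transform_eventually)
qed

lemma chain_rule:
  assumes U: "openin (Euclidean_space n) U"
    and g: "Ck_on (Suc 0) n U g"
    and c: "\<And>h. c h \<in> topspace (Euclidean_space n)" "c t \<in> U"
    and c': "\<And>j. j < n \<Longrightarrow> ((\<lambda>h. c h j) has_real_derivative c' j) (at t)"
  shows "((\<lambda>h. g (c h)) has_real_derivative (\<Sum>j<n. partial_deriv j g (c t) * c' j)) (at t)"
proof -
  define a where "a = c t"
  define z where "z j h = (\<lambda>l. if l < j then c h l else a l)" for j h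
  have aE: "a \<in> topspace (Euclidean_space n)" using c a_def by auto
  have z0: "z 0 h = a" and zn: "z n h = c h" for h
    using c(1)[of h] aE by (auto simp: z_def fun_eq_iff topspace_Euclidean_space)
  have zS: "z (Suc j) h = (z j h)(j := c h j)" and zj: "z j h = (z j h)(j := a j)" for j h
    by (auto simp: z_def fun_eq_iff)
  have lim: "((\<lambda>h. c h i) \<longlongrightarrow> a i) (at t)" if "i < n" for i
    using DERIV_isCont[OF c'[OF that]] by (simp add: isCont_def a_def)
  have "((\<lambda>h. (g (z (Suc j) h) - g (z j h)) / (h - t)) \<longlongrightarrow> partial_deriv j g a * c' j) (at t)"
    if j: "j < n" for j
  proof -
    have "((\<lambda>h. (g ((z j h)(j := c h j)) - g ((z j h)(j := a j))) / (h - t)) \<longlongrightarrow>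
        partial_deriv j g a * c' j) (at t)"
    proof (rule chain_step[OF U _ j])
      show "a \<in> U" "c t j = a j" using c a_def by auto
      show "z j h \<in> topspace (Euclidean_space n)" for h
        using c(1)[of h] aE by (auto simp: z_def topspace_Euclidean_space)
      show "((\<lambda>h. z j h i) \<longlongrightarrow> a i) (at t)" if "i < n" for i
        using lim[OF that] by (cases "i < j") (auto simp: z_def)
    qed (use g j c' in auto)
    then show ?thesis
      by (simp only: zS zj[symmetric])
  qed
  then have "((\<lambda>h. \<Sum>j<n. (g (z (Suc j) h) - g (z j h)) / (h - t)) \<longlongrightarrow>
      (\<Sum>j<n. partial_deriv j g a * c' j)) (at t)"
    by (intro tendsto_sum) auto
  moreover have "(\<Sum>j<n. (g (z (Suc j) h) - g (z j h)) / (h - t)) = (g (c h) - g (c t)) / (h - t)" for h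
    using sum_lessThan_telescope[of "\<lambda>j. g (z j h)" n]
    by (simp add: sum_divide_distrib[symmetric] z0 zn a_def)
  ultimately show ?thesis
    by (simp add: has_field_derivative_iff a_def)
qed

lemma Ck_on_compose:
  assumes V: "openin (Euclidean_space m) V" and U: "openin (Euclidean_space n) U"
    and f: "f \<in> V \<rightarrow> U" 
  shows "Ck_on k n U g \<Longrightarrow> (\<And>j. j < n \<Longrightarrow> Ck_on k m V (\<lambda>x. f x j)) \<Longrightarrow> Ck_on k m V (\<lambda>x. g (f x))"
proof (induction k arbitrary: g)
  case 0
  have "continuous_on V f"
  proof (rule continuous_on_coordinatewise_then_product)
    fix j show "continuous_on V (\<lambda>x. f x j)"
    proof (cases "j < n")
      case False
      then have "f x j = 0" if "x \<in> V" for x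
        using funcset_mem[OF f that] openin_in_topspace[OF U, of "f x"] False
        by (auto simp: topspace_Euclidean_space)
      then show ?thesis by (simp cong: continuous_on_cong)
    qed (use 0 in auto)
  qed
  then show ?case
    using 0 f continuous_on_compose2[of U g V f] by auto
next
  case (Suc k)
  have le: "Ck_on k n U g" "\<And>j. j < n \<Longrightarrow> Ck_on k m V (\<lambda>x. f x j)"
    using Suc.prems Ck_on_Suc_imp by blast+
  have gf: "continuous_on V (\<lambda>x. g (f x))"
    using Suc.IH[OF le] Ck_on_continuous by blast
  have D: "((\<lambda>h. g (f (x(i := h)))) has_real_derivative
      (\<Sum>j<n. partial_deriv j g (f x) * partial_deriv i (\<lambda>x. f x j) x)) (at (x i))"
    if i: "i < m" and x: "x \<in> V" for i x
  proof -
    define c where "c h = (if x(i := h) \<in> V then f (x(i := h)) else f x)" for h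
    have ev: "eventually (\<lambda>h. c h = f (x(i := h))) (nhds (x i))"
      using eventually_fun_upd[OF V x i] by eventually_elim (auto simp: c_def)
    have cx: "c (x i) = f x" by (auto simp: c_def)
    have "((\<lambda>h. g (c h)) has_real_derivative
      (\<Sum>j<n. partial_deriv j g (c (x i)) * partial_deriv i (\<lambda>x. f x j) x)) (at (x i))"
    proof (rule chain_rule[OF U])
      show "Ck_on (Suc 0) n U g"
        using Suc.prems(1) Ck_on_continuous by auto
      have "c h \<in> U" for h
        using f x by (auto simp: c_def)
      then show "c h \<in> topspace (Euclidean_space n)" "c (x i) \<in> U" for h
        using openin_in_topspace[OF U] by auto
      fix j assume "j < n"
      then have "((\<lambda>h. f (x(i := h)) j) has_real_derivative partial_deriv i (\<lambda>x. f x j) x) (at (x i))"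
        using Suc.prems(2) i x pd_deriv[of "\<lambda>x. f x j" x i] by auto
      moreover have "eventually (\<lambda>h. c h j = f (x(i := h)) j) (nhds (x i))"
        using ev by eventually_elim auto
      ultimately show "((\<lambda>h. c h j) has_real_derivative partial_deriv i (\<lambda>x. f x j) x) (at (x i))"
        by (rule DERIV_ev)
    qed
    moreover have "eventually (\<lambda>h. g (f (x(i := h))) = g (c h)) (nhds (x i))"
      using ev by eventually_elim auto
    ultimately show ?thesis
      unfolding cx by (rule DERIV_ev)
  qed
  have "Ck_on k m V (\<lambda>x. \<Sum>j<n. partial_deriv j g (f x) * partial_deriv i (\<lambda>x. f x j) x)"
    if "i < m" for i
    using Suc.prems that le
    by (intro Ck_on_sum Ck_on_mult V Suc.IH[of "partial_deriv _ g"]) auto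
  then show ?case
    using gf D by (intro Ck_on_SucI'[OF V, where D = "\<lambda>i x. \<Sum>j<n. partial_deriv j g (f x) * partial_deriv i (\<lambda>x. f x j) x"])
qed

lemma smooth_fun_cong:
  "openin (Euclidean_space n) U \<Longrightarrow> smooth_fun n U f \<Longrightarrow> (\<And>x. x \<in> U \<Longrightarrow> g x = f x) \<Longrightarrow> smooth_fun n U g"
  unfolding smooth_fun_def using Ck_on_cong by blast

lemma smooth_fun_const: "openin (Euclidean_space n) U \<Longrightarrow> smooth_fun n U (\<lambda>x. c)"
  unfolding smooth_fun_def using Ck_on_const by blast

lemma smooth_fun_subset: "smooth_fun n U f \<Longrightarrow> W \<subseteq> U \<Longrightarrow> smooth_fun n W f"
  unfolding smooth_fun_def using Ck_on_subset by blast

lemma smooth_fun_local: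
  assumes "openin (Euclidean_space n) U"
    "\<And>x. x \<in> U \<Longrightarrow> \<exists>W. x \<in> W \<and> W \<subseteq> U \<and> openin (Euclidean_space n) W \<and> smooth_fun n W f"
  shows "smooth_fun n U f"
  unfolding smooth_fun_def
proof
  show "Ck_on k n U f" for k
    using assms(2) unfolding smooth_fun_def by (intro Ck_on_local assms(1)) blast
qed

lemma smooth_fun_compose:
  assumes "openin (Euclidean_space m) V" "openin (Euclidean_space n) U"
    and "smooth_between m V n U f" "smooth_fun n U g"
  shows "smooth_fun m V (g \<circ> f)"
  using assms Ck_on_compose[OF assms(1,2)]
  by (auto simp: smooth_fun_def smooth_between_def comp_def)

lemma openin_preimage:
  assumes U: "openin (Euclidean_space n) U" and V: "openin (Euclidean_space m) V"
    and q: "smooth_between m V n U q" and W: "openin (Euclidean_space n) W"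
  shows "openin (Euclidean_space m) {v \<in> V. q v \<in> W}"
proof -
  have "continuous_on V (\<lambda>v. q v j)" for j
  proof (cases "j < n")
    case True
    then show ?thesis
      using q Ck_on_continuous[of 0 m V "\<lambda>v. q v j"] unfolding smooth_between_def smooth_fun_def by blast
  next
    case False
    have "q v j = 0" if "v \<in> V" for v
      using q that False openin_in_topspace[OF U, of "q v"]
      by (auto simp: smooth_between_def topspace_Euclidean_space Pi_iff)
    then show ?thesis by (simp cong: continuous_on_cong)
  qed
  then have c: "continuous_on V q"
    by (rule continuous_on_coordinatewise_then_product)
  obtain S where S: "open S" "W = S \<inter> topspace (Euclidean_space n)"
    using W openin_Euclidean_space_alt by blast
  have "{v \<in> V. q v \<in> W} = V \<inter> q -` S"
    using q S openin_in_topspace[OF U] by (auto simp: smooth_between_def Pi_iff)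
  moreover have "openin (top_of_set V) (V \<inter> q -` S)"
    using c S by (intro continuous_openin_preimage_gen)
  ultimately obtain T where "open T" "{v \<in> V. q v \<in> W} = V \<inter> T"
    by (auto simp: openin_open)
  moreover obtain T' where "open T'" "V = T' \<inter> topspace (Euclidean_space m)"
    using V openin_Euclidean_space_alt by blast
  ultimately show ?thesis
    unfolding openin_Euclidean_space_alt by (intro exI[of _ "T \<inter> T'"]) auto
qed


section \<open>The spaces above satisfy the axioms of diffeological spaces\<close>

lemma diffeological_space_real_space: "diffeological_space real_space"
proof
  fix p :: "(nat \<Rightarrow> real) \<Rightarrow> real" and n U
  assume "openin (Euclidean_space n) U"
    "\<And>x. x \<in> U \<Longrightarrow> \<exists>W. x \<in> W \<and> W \<subseteq> U \<and> openin (Euclidean_space n) W \<and> p \<in> plots real_space n W"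
  then show "p \<in> plots real_space n U"
    by (auto simp: real_space_def intro!: smooth_fun_local)
next
  fix p q :: "(nat \<Rightarrow> real) \<Rightarrow> real" and n U
  assume "p \<in> plots real_space n U" "\<And>x. x \<in> U \<Longrightarrow> q x = p x"
  then show "q \<in> plots real_space n U"
    using smooth_fun_cong[of n U p q] by (auto simp: real_space_def)
next
  fix p f n U m V
  assume "p \<in> plots real_space n U" "openin (Euclidean_space m) V" "smooth_between m V n U f"
  then show "p \<circ> f \<in> plots real_space m V"
    using smooth_fun_compose[of m V n U f p] by (auto simp: real_space_def)
qed (auto simp: real_space_def intro: smooth_fun_const)

lemma diffeological_space_open_space:
  assumes U: "openin (Euclidean_space n) U"
  shows "diffeological_space (open_space n U)"
proof
  fix p q :: "(nat \<Rightarrow> real) \<Rightarrow> nat \<Rightarrow> real" and m V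
  assume "p \<in> plots (open_space n U) m V" "\<And>x. x \<in> V \<Longrightarrow> q x = p x"
  then show "q \<in> plots (open_space n U) m V"
    by (auto simp: open_space_def smooth_between_def Pi_iff intro: smooth_fun_cong)
next
  fix p f and m V l W
  assume p: "p \<in> plots (open_space n U) m V" and W: "openin (Euclidean_space l) W"
    and f: "smooth_between l W m V f"
  then have "smooth_fun l W ((\<lambda>x. p x j) \<circ> f)" if "j < n" for j
    using that by (intro smooth_fun_compose[of l W m V]) (auto simp: open_space_def smooth_between_def)
  then show "p \<circ> f \<in> plots (open_space n U) l W"
    using p f W by (auto simp: open_space_def smooth_between_def Pi_iff comp_def)
next
  fix p :: "(nat \<Rightarrow> real) \<Rightarrow> nat \<Rightarrow> real" and m V
  assume V: "openin (Euclidean_space m) V" and loc: "\<And>x. x \<in> V \<Longrightarrow>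
    \<exists>W. x \<in> W \<and> W \<subseteq> V \<and> openin (Euclidean_space m) W \<and> p \<in> plots (open_space n U) m W"
  have "smooth_fun m V (\<lambda>x. p x j)" if "j < n" for j
    using loc that by (intro smooth_fun_local V) (fastforce simp: open_space_def smooth_between_def)
  moreover have "p \<in> V \<rightarrow> U"
    using loc by (fastforce simp: open_space_def smooth_between_def)
  ultimately show "p \<in> plots (open_space n U) m V"
    using V by (auto simp: open_space_def smooth_between_def)
qed (auto simp: open_space_def smooth_between_def intro: smooth_fun_const)

lemma diffeological_space_induced_space:
  assumes "diffeological_space X" "A \<subseteq> points X"
  shows "diffeological_space (induced_space X A)"
proof -
  interpret diffeological_space X by fact
  show ?thesis
  proof
    fix p q n U assume "p \<in> plots (induced_space X A) n U" "\<And>x. x \<in> U \<Longrightarrow> q x = p x"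
    then show "q \<in> plots (induced_space X A) n U"
      by (auto simp: induced_space_def Pi_iff intro: plot_cong)
  next
    fix p f n U m V
    assume "p \<in> plots (induced_space X A) n U" "openin (Euclidean_space m) V" "smooth_between m V n U f"
    then show "p \<circ> f \<in> plots (induced_space X A) m V"
      by (auto simp: induced_space_def smooth_between_def Pi_iff intro!: plot_precompose)
  next
    fix p n U
    assume U: "openin (Euclidean_space n) U" and loc: "\<And>x. x \<in> U \<Longrightarrow> \<exists>W. x \<in> W \<and> W \<subseteq> U \<and>
      openin (Euclidean_space n) W \<and> p \<in> plots (induced_space X A) n W"
    have "p \<in> plots X n U"
      using loc by (intro plot_local U) (fastforce simp: induced_space_def)
    moreover have "p \<in> U \<rightarrow> A"
      using loc by (fastforce simp: induced_space_def)
    ultimately show "p \<in> plots (induced_space X A) n U"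
      by (auto simp: induced_space_def)
  qed (use assms in \<open>auto simp: induced_space_def intro: plot_domain plot_const\<close>)
qed

lemma diffeological_space_product_space:
  assumes "diffeological_space X" "diffeological_space Y"
  shows "diffeological_space (product_space X Y)"
proof -
  interpret X: diffeological_space X by fact
  interpret Y: diffeological_space Y by fact
  show ?thesis
  proof
    fix p n U assume "p \<in> plots (product_space X Y) n U"
    then show "p \<in> U \<rightarrow> points (product_space X Y)"
      using X.plot_values[of "fst \<circ> p" n U] Y.plot_values[of "snd \<circ> p" n U]
      by (auto simp: product_space_def Pi_iff mem_Times_iff)
  next
    fix p q n U assume "p \<in> plots (product_space X Y) n U" "\<And>x. x \<in> U \<Longrightarrow> q x = p x"
    then show "q \<in> plots (product_space X Y) n U"
      by (auto simp: product_space_def intro: X.plot_cong Y.plot_cong)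
  next
    fix p f n U m V
    assume "p \<in> plots (product_space X Y) n U" "openin (Euclidean_space m) V" "smooth_between m V n U f"
    then show "p \<circ> f \<in> plots (product_space X Y) m V"
      using X.plot_precompose[of "fst \<circ> p" n U m V f] Y.plot_precompose[of "snd \<circ> p" n U m V f]
      by (auto simp: product_space_def comp_assoc)
  next
    fix p n U
    assume U: "openin (Euclidean_space n) U" and loc: "\<And>x. x \<in> U \<Longrightarrow> \<exists>W. x \<in> W \<and> W \<subseteq> U \<and>
      openin (Euclidean_space n) W \<and> p \<in> plots (product_space X Y) n W"
    have "fst \<circ> p \<in> plots X n U" "snd \<circ> p \<in> plots Y n U"
      using loc by (auto simp: product_space_def intro!: X.plot_local[OF U] Y.plot_local[OF U])
    then show "p \<in> plots (product_space X Y) n U"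
      by (auto simp: product_space_def)
  qed (auto simp: product_space_def comp_def X.plot_domain X.plot_const Y.plot_const)
qed

lemma diffeological_space_nonneg_space: "diffeological_space nonneg_space"
  unfolding nonneg_space_def
  by (rule diffeological_space_induced_space[OF diffeological_space_real_space])
     (auto simp: real_space_def)

lemma diffeological_space_test_fun_space: "diffeological_space test_fun_space"
proof
  fix p q :: "(nat \<Rightarrow> real) \<Rightarrow> test_fun" and n U
  assume "p \<in> plots test_fun_space n U" "\<And>x. x \<in> U \<Longrightarrow> q x = p x"
  then show "q \<in> plots test_fun_space n U"
    by (auto simp: test_fun_space_def intro: smooth_fun_cong)
next
  fix p f n U m V
  assume "p \<in> plots test_fun_space n U" "openin (Euclidean_space m) V" "smooth_between m V n U f"
  then show "p \<circ> f \<in> plots test_fun_space m V"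
    using smooth_fun_compose[of m V n U f] by (auto simp: test_fun_space_def comp_assoc[symmetric])
next
  fix p :: "(nat \<Rightarrow> real) \<Rightarrow> test_fun" and n U
  assume U: "openin (Euclidean_space n) U" and loc: "\<And>x. x \<in> U \<Longrightarrow> \<exists>W. x \<in> W \<and> W \<subseteq> U \<and>
    openin (Euclidean_space n) W \<and> p \<in> plots test_fun_space n W"
  have "smooth_fun n U (T \<circ> p)" if "T \<in> distributions" for T
    using loc that by (intro smooth_fun_local U) (fastforce simp: test_fun_space_def)
  then show "p \<in> plots test_fun_space n U"
    using U by (auto simp: test_fun_space_def)
qed (auto simp: test_fun_space_def comp_def intro: smooth_fun_const)

lemma distribution_plot_iff:
  "p \<in> plots distribution_space n U \<longleftrightarrow>
     openin (Euclidean_space n) U \<and> p \<in> U \<rightarrow> distributions \<and>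
     (\<forall>m V f \<phi>. openin (Euclidean_space m) V \<longrightarrow> smooth_between m V n U f \<longrightarrow>
        \<phi> \<in> plots test_fun_space m V \<longrightarrow> smooth_fun m V (\<lambda>v. p (f v) (\<phi> v)))"
  (is "?L \<longleftrightarrow> ?R")
proof
  assume L: ?L
  have "smooth_fun m V (\<lambda>v. p (f v) (\<phi> v))"
    if "openin (Euclidean_space m) V" "smooth_between m V n U f" "\<phi> \<in> plots test_fun_space m V" for m V f \<phi>
  proof -
    have "(\<lambda>v. (f v, \<phi> v)) \<in> plots (product_space (open_space n U) test_fun_space) m V"
      using that by (auto simp: product_space_def open_space_def comp_def)
    then have "(\<lambda>(x, \<phi>). p x \<phi>) \<circ> (\<lambda>v. (f v, \<phi> v)) \<in> plots real_space m V"
      using L by (auto simp: distribution_space_def smooth_map_def)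
    then show ?thesis by (simp add: real_space_def comp_def)
  qed
  with L show ?R by (auto simp: distribution_space_def)
next
  assume R: ?R
  have "(\<lambda>(x, \<phi>). p x \<phi>) \<circ> q \<in> plots real_space m V"
    if "q \<in> plots (product_space (open_space n U) test_fun_space) m V" for q m V
    using that R by (auto simp: product_space_def open_space_def real_space_def comp_def case_prod_unfold)
  with R show ?L
    by (auto simp: distribution_space_def smooth_map_def real_space_def)
qed

lemma diffeological_space_distribution_space: "diffeological_space distribution_space"
proof
  fix p n U assume "p \<in> plots distribution_space n U"
  then show "openin (Euclidean_space n) U" "p \<in> U \<rightarrow> points distribution_space"
    by (auto simp: distribution_space_def)
next
  fix p q n U assume p: "p \<in> plots distribution_space n U" and eq: "\<And>x. x \<in> U \<Longrightarrow> q x = p x"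
  have "smooth_fun m V (\<lambda>v. q (f v) (\<phi> v))"
    if "openin (Euclidean_space m) V" "smooth_between m V n U f" "\<phi> \<in> plots test_fun_space m V" for m V f \<phi>
  proof (rule smooth_fun_cong)
    show "smooth_fun m V (\<lambda>v. p (f v) (\<phi> v))"
      using p that by (auto simp: distribution_plot_iff)
    show "q (f v) (\<phi> v) = p (f v) (\<phi> v)" if "v \<in> V" for v
      using that eq[of "f v"] \<open>smooth_between m V n U f\<close> by (auto simp: smooth_between_def Pi_iff)
  qed (use that in auto)
  then show "q \<in> plots distribution_space n U"
    using p eq by (auto simp: distribution_plot_iff Pi_iff)
next
  fix a n U assume "openin (Euclidean_space n) U" "a \<in> points distribution_space"
  then show "(\<lambda>x. a) \<in> plots distribution_space n U"
    unfolding distribution_plot_iff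
    by (auto simp: distribution_space_def test_fun_space_def comp_def)
next
  fix p f n U m V
  assume p: "p \<in> plots distribution_space n U" and V: "openin (Euclidean_space m) V"
    and f: "smooth_between m V n U f"
  then have U: "openin (Euclidean_space n) U"
    by (auto simp: distribution_plot_iff)
  have "smooth_fun l W (\<lambda>w. p (f (g w)) (\<phi> w))"
    if g: "openin (Euclidean_space l) W" "smooth_between l W m V g" "\<phi> \<in> plots test_fun_space l W" for l W g \<phi>
  proof -
    have "smooth_between l W n U (f \<circ> g)"
      using diffeological_space.plot_precompose[OF diffeological_space_open_space[OF U], of f m V l W g]
        V f g by (auto simp: open_space_def)
    then have "smooth_fun l W (\<lambda>w. p ((f \<circ> g) w) (\<phi> w))"
      using p g unfolding distribution_plot_iff by blast
    then show ?thesis by simp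
  qed
  then show "p \<circ> f \<in> plots distribution_space m V"
    using p V f by (auto simp: distribution_plot_iff smooth_between_def Pi_iff)
next
  fix p n U
  assume U: "openin (Euclidean_space n) U" and loc: "\<And>x. x \<in> U \<Longrightarrow> \<exists>W. x \<in> W \<and> W \<subseteq> U \<and>
    openin (Euclidean_space n) W \<and> p \<in> plots distribution_space n W"
  have "smooth_fun m V (\<lambda>v. p (f v) (\<phi> v))"
    if V: "openin (Euclidean_space m) V" and f: "smooth_between m V n U f"
      and \<phi>: "\<phi> \<in> plots test_fun_space m V" for m V f \<phi>
  proof (rule smooth_fun_local[OF V])
    fix v assume v: "v \<in> V"
    then have "f v \<in> U" using f by (auto simp: smooth_between_def Pi_iff)
    then obtain W where W: "f v \<in> W" "W \<subseteq> U" "openin (Euclidean_space n) W" "p \<in> plots distribution_space n W"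
      using loc by blast
    define V' where "V' = {v \<in> V. f v \<in> W}"
    have V': "openin (Euclidean_space m) V'" "V' \<subseteq> V"
      unfolding V'_def using openin_preimage[OF U V f W(3)] by auto
    have "smooth_between m V' n W f"
      using f V' by (auto simp: smooth_between_def V'_def intro: smooth_fun_subset)
    moreover have "\<phi> \<in> plots test_fun_space m V'"
      using \<phi> V' by (auto simp: test_fun_space_def intro: smooth_fun_subset)
    ultimately have "smooth_fun m V' (\<lambda>v. p (f v) (\<phi> v))"
      using W(4) V'(1) unfolding distribution_plot_iff by blast
    then show "\<exists>V'. v \<in> V' \<and> V' \<subseteq> V \<and> openin (Euclidean_space m) V' \<and> smooth_fun m V' (\<lambda>v. p (f v) (\<phi> v))"
      using V' v W(1) by (intro exI[of _ V']) (auto simp: V'_def)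
  qed
  moreover have "p \<in> U \<rightarrow> distributions"
    using loc by (fastforce simp: distribution_space_def)
  ultimately show "p \<in> plots distribution_space n U"
    using U by (auto simp: distribution_plot_iff)
qed

end

theory Submission
  imports Defs "HOL-Probability.Distributions"
begin

text \<open>Let \<open>t \<ge> 0\<close> be a smooth function and \<open>\<phi>\<close> a plot of test functions on \<open>V\<close>. On \<open>[0, \<infinity>)\<close> the function
  \<open>\<langle>K(t), \<psi>\<rangle>\<close> has the derivative \<open>\<langle>K(t), \<psi>''\<rangle>\<close>, one-sided at \<open>0\<close>, so that
  \<open>\<partial>\<^sub>i \<langle>K(t), \<phi>\<rangle> = \<langle>K(t), \<phi>''\<rangle> \<partial>\<^sub>i t + \<langle>K(t), \<partial>\<^sub>i \<phi>\<rangle>\<close>.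
  Both terms have the form that one started with, and smoothness follows by induction on the order
  of differentiability; no extension of \<open>K\<close> to negative times is needed. The partial derivative
  \<open>\<partial>\<^sub>i \<phi>\<close> exists as a plot of test functions although \<open>\<phi>\<close> is only weakly smooth: weakly bounded sets
  of test functions have a common compact support and uniformly bounded derivatives, as one sees by
  testing them with the distributions \<open>\<Sum>\<^sub>n c\<^sub>n w(x\<^sub>n) \<delta>\<^sup>(\<^sup>k\<^sup>)(x\<^sub>n)\<close> for absolutely summable \<open>c\<close> and a locally
  bounded weight \<open>w\<close>.\<close>

section \<open>Test functions and distributions\<close>

abbreviation tf_deriv :: "nat \<Rightarrow> test_fun \<Rightarrow> real \<Rightarrow> real" where
  "tf_deriv k \<phi> \<equiv> (deriv ^^ k) (tf_apply \<phi>)"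

lemma tf_deriv_DERIV: "(tf_deriv k \<phi> has_real_derivative tf_deriv (Suc k) \<phi> x) (at x)"
  using tf_apply[of \<phi>] by (simp add: test_function_def DERIV_deriv_iff_real_differentiable)

lemma tf_deriv_continuous: "continuous_on S (tf_deriv k \<phi>)"
  by (intro continuous_at_imp_continuous_on ballI DERIV_isCont[OF tf_deriv_DERIV])

lemma tf_deriv_add: "tf_deriv k (\<phi> + \<psi>) x = tf_deriv k \<phi> x + tf_deriv k \<psi> x"
  using tf_apply[of \<phi>] tf_apply[of \<psi>]
  by (simp add: plus_test_fun.rep_eq higher_deriv_add test_function_def)

lemma tf_deriv_scaleR: "tf_deriv k (c *\<^sub>R \<phi>) x = c * tf_deriv k \<phi> x"
  using tf_apply[of \<phi>] by (simp add: scaleR_test_fun.rep_eq higher_deriv_cmult test_function_def)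

lemma tf_deriv_diff: "tf_deriv k (\<phi> - \<psi>) x = tf_deriv k \<phi> x - tf_deriv k \<psi> x"
  using tf_deriv_add[of k "\<phi> - \<psi>" \<psi> x] by simp

lemma higher_deriv_cong_open:
  fixes f g :: "real \<Rightarrow> real"
  assumes "open S" "\<And>x. x \<in> S \<Longrightarrow> f x = g x" "x \<in> S"
  shows "(deriv ^^ k) f x = (deriv ^^ k) g x"
  using assms(3)
proof (induction k arbitrary: x)
  case (Suc k)
  have "eventually (\<lambda>y. (deriv ^^ k) f y = (deriv ^^ k) g y) (nhds x)"
    using Suc assms(1) eventually_nhds by blast
  then show ?case by (simp add: deriv_cong_ev)
qed (use assms in auto)

lemma supported_in_iff: "closed K \<Longrightarrow> \<phi> \<in> supported_in K \<longleftrightarrow> (\<forall>x. x \<notin> K \<longrightarrow> tf_apply \<phi> x = 0)"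
proof -
  assume K: "closed K"
  have "\<phi> \<in> supported_in K \<longleftrightarrow> {x. tf_apply \<phi> x \<noteq> 0} \<subseteq> K"
    unfolding supported_in_def using closure_minimal[OF _ K] closure_subset[of "{x. tf_apply \<phi> x \<noteq> 0}"]
    by (metis mem_Collect_eq order_trans)
  then show ?thesis by auto
qed

lemma tf_deriv_eq_0:
  assumes "\<phi> \<in> supported_in K" "closed K" "x \<notin> K"
  shows "tf_deriv k \<phi> x = 0"
proof -
  have "tf_deriv k \<phi> x = (deriv ^^ k) (\<lambda>x. 0) x"
    by (rule higher_deriv_cong_open[of "- K"]) (use assms supported_in_iff in auto)
  then show ?thesis by (simp add: higher_deriv_zero)
qed

lemma supported_in_compact:
  obtains K where "compact K" "\<phi> \<in> supported_in K"
proof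
  show "compact (closure {x. tf_apply \<phi> x \<noteq> 0})"
    using tf_apply[of \<phi>] unfolding test_function_def by blast
  show "\<phi> \<in> supported_in (closure {x. tf_apply \<phi> x \<noteq> 0})"
    by (simp add: supported_in_def)
qed

lemma compact_subset_interval:
  assumes "compact (K :: real set)"
  obtains R where "R > 0" "K \<subseteq> {-R..R}"
proof -
  obtain b where "b > 0" "\<forall>x\<in>K. norm x \<le> b"
    using compact_imp_bounded[OF assms] bounded_pos by blast
  then have "K \<subseteq> {-b..b}" by force
  with \<open>b > 0\<close> show ?thesis using that by blast
qed

lemma supported_in_mono: "\<phi> \<in> supported_in K \<Longrightarrow> K \<subseteq> L \<Longrightarrow> \<phi> \<in> supported_in L"
  by (auto simp: supported_in_def)

lemma supported_in_interval:
  obtains R where "R > 0" "\<phi> \<in> supported_in {-R..R}"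
proof -
  obtain K where K: "compact K" "\<phi> \<in> supported_in K" using supported_in_compact .
  obtain R where "R > 0" "K \<subseteq> {-R..R}" using compact_subset_interval[OF K(1)] .
  with K show ?thesis using supported_in_mono that by blast
qed

lemma supported_in_diff:
  "closed K \<Longrightarrow> \<phi> \<in> supported_in K \<Longrightarrow> \<psi> \<in> supported_in K \<Longrightarrow> \<phi> - \<psi> \<in> supported_in K"
  by (simp add: supported_in_iff minus_test_fun.rep_eq)

section \<open>Bounds on derivatives, and continuity of linear functionals\<close>

lemma tf_deriv_bounded:
  obtains C where "C > 0" "\<And>x. \<bar>tf_deriv k \<phi> x\<bar> \<le> C"
proof -
  obtain R where R: "R > 0" "\<phi> \<in> supported_in {-R..R}"
    using supported_in_interval by blast
  have "compact (tf_deriv k \<phi> ` {-R..R})"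
    by (intro compact_continuous_image tf_deriv_continuous) auto
  then obtain C where C: "C > 0" "\<And>x. x \<in> {-R..R} \<Longrightarrow> \<bar>tf_deriv k \<phi> x\<bar> \<le> C"
    using compact_imp_bounded bounded_pos by (metis image_eqI real_norm_def)
  have "\<bar>tf_deriv k \<phi> x\<bar> \<le> C" for x
    using C tf_deriv_eq_0[OF R(2), of x k] by (cases "x \<in> {-R..R}") auto
  with C(1) show ?thesis using that by blast
qed

text \<open>An estimate by finitely many derivatives makes each set
  \<open>{\<psi>. \<bar>T \<psi>\<bar> < e}\<close> a basic neighbourhood of zero; by linearity its
  translates give continuity everywhere. The criterion serves for derivatives of delta, for weighted
  series of these and for \<open>heat t\<close>.\<close>

lemma distributionsI:
  assumes lin: "linear T"
    and bd: "\<And>R. R > 0 \<Longrightarrow> \<exists>N C. \<forall>\<psi>\<in>supported_in {-R..R}. \<forall>b.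
      (\<forall>k\<le>N. \<forall>x. \<bar>tf_deriv k \<psi> x\<bar> \<le> b) \<longrightarrow> \<bar>T \<psi>\<bar> \<le> C * b"
  shows "T \<in> distributions"
proof -
  interpret linear T by fact
  have nhd: "basic_nhd {\<psi>. \<bar>T \<psi>\<bar> < e}" if e: "e > 0" for e
    unfolding basic_nhd_def
  proof (intro conjI allI impI)
    show "{\<psi>. \<bar>T \<psi>\<bar> < e} \<noteq> {}"
      using e zero by (intro ex_in_conv[THEN iffD1] exI[of _ 0]) simp
    have "{\<psi>. \<bar>T \<psi>\<bar> < e} = T -` ball 0 e" by auto
    then show "convex {\<psi>. \<bar>T \<psi>\<bar> < e}"
      using convex_linear_vimage[OF lin, of "ball 0 e"] by simp
    fix c :: real and \<phi> assume "\<bar>c\<bar> \<le> 1" "\<phi> \<in> {\<psi>. \<bar>T \<psi>\<bar> < e}"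
    then show "c *\<^sub>R \<phi> \<in> {\<psi>. \<bar>T \<psi>\<bar> < e}"
      using mult_left_le_one_le[of "\<bar>T \<phi>\<bar>" "\<bar>c\<bar>"] by (simp add: scale abs_mult)
  next
    fix K :: "real set" assume "compact K"
    then obtain R where R: "R > 0" "K \<subseteq> {-R..R}" using compact_subset_interval by blast
    obtain N C where NC: "\<And>\<psi> b. \<psi> \<in> supported_in {-R..R} \<Longrightarrow>
        (\<forall>k\<le>N. \<forall>x. \<bar>tf_deriv k \<psi> x\<bar> \<le> b) \<Longrightarrow> \<bar>T \<psi>\<bar> \<le> C * b"
      using bd[OF R(1)] by metis
    show "open_in_supported K ({\<psi>. \<bar>T \<psi>\<bar> < e} \<inter> supported_in K)"
      unfolding open_in_supported_def
    proof (intro conjI ballI)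
      fix \<phi> assume \<phi>: "\<phi> \<in> {\<psi>. \<bar>T \<psi>\<bar> < e} \<inter> supported_in K"
      \<comment> \<open>The room left below \<open>e\<close>, scaled so that \<open>C * d\<close>
        stays strictly inside it. The added 1 keeps the denominator positive and the inequality
        strict even if \<open>C\<close> is zero.\<close>
      define d where "d = (e - \<bar>T \<phi>\<bar>) / (\<bar>C\<bar> + 1)"
      have "d > 0" using \<phi> by (auto simp: d_def)
      have "\<bar>T \<psi>\<bar> < e" if \<psi>: "\<psi> \<in> supported_in K" and
        s: "\<forall>k\<le>N. \<forall>x. \<bar>tf_deriv k (\<psi> - \<phi>) x\<bar> < d" for \<psi>
      proof -
        have "\<psi> - \<phi> \<in> supported_in {-R..R}"
          using supported_in_diff[of "{-R..R}" \<psi> \<phi>] supported_in_mono[OF _ R(2)] \<phi> \<psi> by auto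
        then have "\<bar>T (\<psi> - \<phi>)\<bar> \<le> C * d"
          by (rule NC) (use s in \<open>auto intro: less_imp_le\<close>)
        also have "\<dots> < (\<bar>C\<bar> + 1) * d" using \<open>d > 0\<close> by (intro mult_strict_right_mono) auto
        also have "\<dots> = e - \<bar>T \<phi>\<bar>" by (simp add: d_def)
        finally show ?thesis by (simp add: diff)
      qed
      with \<open>d > 0\<close> show "\<exists>N. \<exists>\<epsilon>>0. \<forall>\<psi>\<in>supported_in K.
         (\<forall>k\<le>N. \<forall>x. \<bar>tf_deriv k (\<psi> - \<phi>) x\<bar> < \<epsilon>) \<longrightarrow> \<psi> \<in> {\<psi>. \<bar>T \<psi>\<bar> < e} \<inter> supported_in K"
        by (intro exI[of _ N] exI[of _ d]) auto
    qed auto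
  qed
  have "open (T -` S)" if S: "open S" for S
    unfolding open_test_fun_def
  proof
    fix \<phi> assume "\<phi> \<in> T -` S"
    then obtain e where e: "e > 0" "ball (T \<phi>) e \<subseteq> S"
      using S open_contains_ball by (metis vimageE)
    have "(\<lambda>\<psi>. \<phi> + \<psi>) ` {\<psi>. \<bar>T \<psi>\<bar> < e} \<subseteq> T -` S"
    proof safe
      fix \<psi> assume "\<bar>T \<psi>\<bar> < e"
      then have "T (\<phi> + \<psi>) \<in> ball (T \<phi>) e" by (simp add: add dist_real_def)
      then show "\<phi> + \<psi> \<in> T -` S" using e by blast
    qed
    with nhd[OF e(1)] show "\<exists>W. basic_nhd W \<and> (\<lambda>\<psi>. \<phi> + \<psi>) ` W \<subseteq> T -` S" by blast
  qed
  then have "continuous_on UNIV T"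
    by (simp add: continuous_on_open_vimage)
  with lin show ?thesis by (simp add: distributions_def)
qed

text \<open>Up to sign these are the derivatives of the delta distribution at \<open>x\<close>. They
  turn weak information into information about the pointwise values of all derivatives.\<close>

lemma distribution_tf_deriv: "(\<lambda>\<psi>. tf_deriv k \<psi> x) \<in> distributions"
proof (rule distributionsI)
  show "linear (\<lambda>\<psi>. tf_deriv k \<psi> x)"
    by (rule linearI) (simp_all add: tf_deriv_add tf_deriv_scaleR)
  show "\<exists>N C. \<forall>\<psi>\<in>supported_in {- R..R}. \<forall>b. (\<forall>k\<le>N. \<forall>x. \<bar>tf_deriv k \<psi> x\<bar> \<le> b) \<longrightarrow>
      \<bar>tf_deriv k \<psi> x\<bar> \<le> C * b" for R
    by (intro exI[of _ k] exI[of _ 1]) auto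
qed

text \<open>The trace of a basic neighbourhood on the functions supported in \<open>K\<close>
  contains a ball for finitely many derivatives, and \<open>\<psi> n - \<phi>\<close> eventually
  lies in it.\<close>

lemma distribution_tendsto:
  assumes T: "T \<in> distributions" and K: "compact K"
    and supp: "\<And>n. \<psi> n \<in> supported_in K" "\<phi> \<in> supported_in K"
    and lim: "\<And>k. uniform_limit UNIV (\<lambda>n. tf_deriv k (\<psi> n)) (tf_deriv k \<phi>) sequentially"
  shows "(\<lambda>n. T (\<psi> n)) \<longlonglongrightarrow> T \<phi>"
proof (rule topological_tendstoI)
  interpret linear T using T by (simp add: distributions_def)
  have closed: "closed K" using K by (rule compact_imp_closed)
  fix S assume S: "open S" "T \<phi> \<in> S"
  have "continuous_on UNIV T" using T by (simp add: distributions_def)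
  then have "open (T -` S)" using S by (simp add: continuous_on_open_vimage)
  with S obtain W where W: "basic_nhd W" "(\<lambda>\<psi>. \<phi> + \<psi>) ` W \<subseteq> T -` S"
    unfolding open_test_fun_def by blast
  have "0 \<in> W \<inter> supported_in K"
    using basic_nhd_zero[OF W(1)] closed by (simp add: supported_in_iff zero_test_fun.rep_eq)
  moreover have "open_in_supported K (W \<inter> supported_in K)"
    using W(1) K by (simp add: basic_nhd_def)
  ultimately obtain N e where e: "e > 0" "\<And>\<eta>. \<eta> \<in> supported_in K \<Longrightarrow>
      (\<forall>k\<le>N. \<forall>x. \<bar>tf_deriv k (\<eta> - 0) x\<bar> < e) \<Longrightarrow> \<eta> \<in> W \<inter> supported_in K"
    unfolding open_in_supported_def by blast
  have "eventually (\<lambda>n. \<forall>k\<in>{..N}. \<forall>x\<in>UNIV. dist (tf_deriv k (\<psi> n) x) (tf_deriv k \<phi> x) < e) sequentially"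
    using lim e(1) by (intro eventually_ball_finite) (auto simp: uniform_limit_iff)
  then show "eventually (\<lambda>n. T (\<psi> n) \<in> S) sequentially"
  proof eventually_elim
    case (elim n)
    have "\<psi> n - \<phi> \<in> W \<inter> supported_in K"
      using elim by (intro e(2) supported_in_diff closed supp) (auto simp: tf_deriv_diff dist_real_def)
    then have "\<phi> + (\<psi> n - \<phi>) \<in> T -` S" using W(2) by blast
    then show ?case by simp
  qed
qed

section \<open>Weakly bounded sets\<close>

text \<open>The numbers \<open>S + y\<close> and \<open>S - y\<close> cannot both be smaller than
  \<open>y\<close> in absolute value, since they differ by \<open>2 * y\<close>. So one of the two
  signs keeps the new term from being cancelled by the sum \<open>S\<close> of the earlier
  ones.\<close>

lemma signed_geometric_choice:
  fixes G :: "nat \<Rightarrow> nat \<Rightarrow> real"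
  shows "\<exists>c. \<forall>n. \<bar>c n\<bar> = (1/3)^n \<and> \<bar>(\<Sum>k<n. c k * G n k) + c n * G n n\<bar> \<ge> (1/3)^n * \<bar>G n n\<bar>"
proof (rule dependent_wellorder_choice)
  \<comment> \<open>The condition on the \<open>n\<close>-th coefficient involves only those before
    it, as a choice by recursion requires.\<close>
  fix r :: real and f g :: "nat \<Rightarrow> real" and n
  assume "\<And>k. k < n \<Longrightarrow> f k = g k"
  then have "(\<Sum>k<n. f k * G n k) = (\<Sum>k<n. g k * G n k)" by (intro sum.cong) auto
  then show "(\<bar>r\<bar> = (1/3)^n \<and> (1/3)^n * \<bar>G n n\<bar> \<le> \<bar>(\<Sum>k<n. f k * G n k) + r * G n n\<bar>) =
    (\<bar>r\<bar> = (1/3)^n \<and> (1/3)^n * \<bar>G n n\<bar> \<le> \<bar>(\<Sum>k<n. g k * G n k) + r * G n n\<bar>)" by simp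
next
  fix n and f :: "nat \<Rightarrow> real"
  define y :: real where "y = (1/3)^n * G n n"
  have y: "(1/3)^n * \<bar>G n n\<bar> = \<bar>y\<bar>" by (simp add: y_def abs_mult)
  have "\<bar>y\<bar> \<le> \<bar>(\<Sum>k<n. f k * G n k) + y\<bar> \<or> \<bar>y\<bar> \<le> \<bar>(\<Sum>k<n. f k * G n k) - y\<bar>" by linarith
  then show "\<exists>r. \<bar>r\<bar> = (1/3)^n \<and> (1/3)^n * \<bar>G n n\<bar> \<le> \<bar>(\<Sum>k<n. f k * G n k) + r * G n n\<bar>"
  proof
    assume "\<bar>y\<bar> \<le> \<bar>(\<Sum>k<n. f k * G n k) + y\<bar>"
    then show ?thesis unfolding y by (intro exI[of _ "(1/3)^n"]) (auto simp: y_def)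
  next
    assume "\<bar>y\<bar> \<le> \<bar>(\<Sum>k<n. f k * G n k) - y\<bar>"
    then show ?thesis unfolding y by (intro exI[of _ "-((1/3)^n)"]) (auto simp: y_def)
  qed
qed

text \<open>Uniform boundedness on \<open>\<ell>\<^sup>1\<close>, by Sokal's argument: the signs of a fixed geometric sequence of
  coefficients are chosen such that the \<open>n\<close>-th term is not cancelled by the earlier ones, and the
  later ones are too small to cancel it.\<close>

lemma uniform_boundedness_l1:
  fixes g :: "'i \<Rightarrow> 's \<Rightarrow> real"
  assumes bd: "\<And>i. i \<in> I \<Longrightarrow> \<exists>M. \<forall>s. \<bar>g i s\<bar> \<le> M"
    and weak: "\<And>c x. summable (\<lambda>k::nat. \<bar>c k\<bar>) \<Longrightarrow> \<exists>M. \<forall>i\<in>I. \<bar>\<Sum>k. c k * g i (x k)\<bar> \<le> M"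
  shows "\<exists>M. \<forall>i\<in>I. \<forall>s. \<bar>g i s\<bar> \<le> M"
proof (rule ccontr)
  assume "\<not> ?thesis"
  then have unb: "\<exists>i\<in>I. \<exists>s. \<bar>g i s\<bar> > M" for M
    by (meson not_le)
  \<comment> \<open>The constants are balanced: in units of \<open>N * (1/3)^n\<close>, the chosen
    term exceeds 3/4 and the tail of the series is at most 1/2. This leaves 1/4, and the growth
    \<open>4^n\<close> of \<open>N\<close> makes the remainder unbounded.\<close>
  have "\<exists>i\<in>I. \<exists>s N. 4^n \<le> N \<and> (\<forall>s'. \<bar>g i s'\<bar> \<le> N) \<and> \<bar>g i s\<bar> > 3/4 * N" for n :: nat
  proof -
    obtain i s where i: "i \<in> I" "\<bar>g i s\<bar> > 4^n" using unb by blast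
    define N where "N = (SUP s. \<bar>g i s\<bar>)"
    have bdd: "bdd_above (range (\<lambda>s. \<bar>g i s\<bar>))"
      using bd[OF i(1)] by (auto simp: bdd_above_def)
    have le: "\<bar>g i s'\<bar> \<le> N" for s'
      unfolding N_def by (rule cSUP_upper[OF _ bdd]) simp
    have "(4::real)^n > 0" by simp
    then have "N > 0" "4^n \<le> N" using i(2) le[of s] by linarith+
    then have "3/4 * N < (SUP s. \<bar>g i s\<bar>)" by (simp add: N_def[symmetric])
    then obtain s' where "\<bar>g i s'\<bar> > 3/4 * N"
      unfolding less_cSUP_iff[OF UNIV_not_empty bdd] by blast
    with i(1) le \<open>4^n \<le> N\<close> show ?thesis by blast
  qed
  then obtain i s N where iI: "\<And>n. i n \<in> I" and N: "\<And>n. 4^n \<le> (N n :: real)"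
    and up: "\<And>n s'. \<bar>g (i n) s'\<bar> \<le> N n" and low: "\<And>n. \<bar>g (i n) (s n)\<bar> > 3/4 * N n"
    by metis
  obtain c where c: "\<And>n. \<bar>c n\<bar> = (1/3)^n"
    "\<And>n. (1/3)^n * \<bar>g (i n) (s n)\<bar> \<le> \<bar>(\<Sum>k<n. c k * g (i n) (s k)) + c n * g (i n) (s n)\<bar>"
    using signed_geometric_choice[of "\<lambda>n k. g (i n) (s k)"] by blast
  have "summable (\<lambda>n. \<bar>c n\<bar>)" by (simp add: c summable_geometric)
  then obtain M where M: "\<And>j. j \<in> I \<Longrightarrow> \<bar>\<Sum>k. c k * g j (s k)\<bar> \<le> M"
    using weak by blast
  have lower: "1/4 * (4/3)^n \<le> M" for n
  proof -
    let ?f = "\<lambda>k. c k * g (i n) (s k)"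
    have N0: "N n > 0" using N[of n] zero_less_power[of "4::real" n] by linarith
    have fle: "\<bar>?f k\<bar> \<le> N n * (1/3)^k" for k
      using up[of n "s k"] by (simp add: abs_mult c mult.commute mult_left_mono divide_right_mono power_divide)
    have geo: "summable (\<lambda>k. N n * (1/3::real)^k)" by (intro summable_mult summable_geometric) auto
    have sumf: "summable ?f"
      by (rule summable_comparison_test'[OF geo, of 0]) (use fle in auto)
    have suminf_norm_le: "\<bar>suminf F\<bar> \<le> suminf G" if "\<And>k. \<bar>F k\<bar> \<le> G k" "summable G" for F G :: "nat \<Rightarrow> real"
    proof -
      have "summable (\<lambda>k. \<bar>F k\<bar>)"
        by (rule summable_comparison_test'[OF that(2), of 0]) (use that(1) in auto)
      then show ?thesis
        using summable_rabs suminf_le[OF that(1) _ that(2)] by (meson order_trans)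
    qed
    have tail: "\<bar>\<Sum>k. ?f (k + Suc n)\<bar> \<le> (\<Sum>k. N n * (1/3)^(k + Suc n))"
      by (rule suminf_norm_le[OF fle summable_ignore_initial_segment[OF geo]])
    have "(\<Sum>k. N n * (1/3)^(k + Suc n)) = (\<Sum>k. (N n * (1/3)^Suc n) * (1/3)^k)"
      by (intro suminf_cong) (simp add: power_add power_divide)
    also have "\<dots> = N n * (1/3)^n / 2"
      by (subst suminf_mult) (auto simp: suminf_geometric summable_geometric power_divide)
    finally have tail': "\<bar>\<Sum>k. ?f (k + Suc n)\<bar> \<le> N n * (1/3)^n / 2" using tail by simp
    have "(\<Sum>k. ?f k) = (\<Sum>k. ?f (k + Suc n)) + ((\<Sum>k<n. ?f k) + ?f n)"
      using suminf_split_initial_segment[OF sumf, of "Suc n"] by simp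
    then have "\<bar>\<Sum>k. ?f k\<bar> \<ge> (1/3)^n * \<bar>g (i n) (s n)\<bar> - N n * (1/3)^n / 2"
      using c(2)[of n] tail' by linarith
    moreover have "(1/3)^n * \<bar>g (i n) (s n)\<bar> \<ge> (1/3)^n * (3/4 * N n)"
      using low[of n] by (intro mult_left_mono) auto
    moreover have "(1/3)^n * (3/4 * N n) - N n * (1/3)^n / 2 = 1/4 * (1/3)^n * N n" by simp
    moreover have "1/4 * (1/3)^n * N n \<ge> 1/4 * (1/3)^n * 4^n"
      using N by (intro mult_left_mono) auto
    moreover have "1/4 * (1/3)^n * 4^n = 1/4 * (4/3::real)^n" by (simp add: power_divide)
    ultimately show ?thesis using M[OF iI, of n] by linarith
  qed
  obtain n where "(4/3::real)^n > 4 * M"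
    using real_arch_pow[of "4/3" "4 * M"] by auto
  with lower[of n] show False by simp
qed

section \<open>Common bounds and common supports for weakly bounded sets\<close>

definition weakly_bounded :: "test_fun set \<Rightarrow> bool" where
  "weakly_bounded B \<longleftrightarrow> (\<forall>T\<in>distributions. bounded (T ` B))"

text \<open>For summable \<open>c\<close> the series \<open>T\<close> in the proof is a
  distribution, because only the values of \<open>w\<close> on the support count; so weak
  boundedness supplies the hypothesis of \<open>uniform_boundedness_l1\<close>. The weight 1 will
  bound derivatives, a weight growing along a sequence will bound supports.\<close>

lemma weakly_bounded_weighted:
  assumes B: "weakly_bounded B"
    and w: "\<And>R. \<exists>C. \<forall>s. \<bar>s\<bar> \<le> R \<longrightarrow> \<bar>w s\<bar> \<le> C"
  shows "\<exists>M. \<forall>\<psi>\<in>B. \<forall>s. \<bar>w s * tf_deriv k \<psi> s\<bar> \<le> M"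
proof (rule uniform_boundedness_l1)
  \<comment> \<open>One estimate with two uses: it bounds each single function and, as
    \<open>C\<close> depends on \<open>R\<close> and not on \<open>\<psi>\<close>, it gives the
    continuity of \<open>T\<close>.\<close>
  have bd: "\<exists>C\<ge>0. \<forall>\<psi>\<in>supported_in {-R..R}. \<forall>b. (\<forall>x. \<bar>tf_deriv k \<psi> x\<bar> \<le> b) \<longrightarrow>
      (\<forall>s. \<bar>w s * tf_deriv k \<psi> s\<bar> \<le> C * b)" for R
  proof -
    obtain C where C: "\<And>s. \<bar>s\<bar> \<le> R \<Longrightarrow> \<bar>w s\<bar> \<le> C" using w by blast
    have "\<bar>w s * tf_deriv k \<psi> s\<bar> \<le> \<bar>C\<bar> * b"
      if \<psi>: "\<psi> \<in> supported_in {-R..R}" and b: "\<forall>x. \<bar>tf_deriv k \<psi> x\<bar> \<le> b" for \<psi> b s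
    proof (cases "\<bar>s\<bar> \<le> R")
      case True
      then have "\<bar>w s\<bar> \<le> \<bar>C\<bar>" using C[of s] by linarith
      with b show ?thesis by (simp add: abs_mult mult_mono)
    next
      case False
      then have "tf_deriv k \<psi> s = 0" using \<psi> by (intro tf_deriv_eq_0) auto
      moreover have "0 \<le> b" using b abs_ge_zero order_trans by blast
      ultimately show ?thesis by simp
    qed
    then show ?thesis by (intro exI[of _ "\<bar>C\<bar>"]) auto
  qed
  show gbd: "\<exists>M. \<forall>s. \<bar>w s * tf_deriv k \<psi> s\<bar> \<le> M" for \<psi>
  proof -
    obtain R where R: "\<psi> \<in> supported_in {-R..R}" using supported_in_interval .
    obtain b where "\<forall>x. \<bar>tf_deriv k \<psi> x\<bar> \<le> b" using tf_deriv_bounded[of k \<psi>] by metis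
    with R bd[of R] show ?thesis by blast
  qed
  fix c :: "nat \<Rightarrow> real" and x :: "nat \<Rightarrow> real"
  assume c: "summable (\<lambda>n. \<bar>c n\<bar>)"
  have le: "\<bar>c n * (w (x n) * tf_deriv k \<psi> (x n))\<bar> \<le> \<bar>c n\<bar> * M"
    if "\<forall>s. \<bar>w s * tf_deriv k \<psi> s\<bar> \<le> M" for \<psi> M n
    using that by (simp add: abs_mult mult_left_mono)
  have summ: "summable (\<lambda>n. \<bar>c n * (w (x n) * tf_deriv k \<psi> (x n))\<bar>)" for \<psi>
  proof -
    obtain M where "\<forall>s. \<bar>w s * tf_deriv k \<psi> s\<bar> \<le> M" using gbd by blast
    with le c show ?thesis
      by (intro summable_comparison_test'[OF summable_mult2[OF c, of M], of 0]) auto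
  qed
  define T where "T \<psi> = (\<Sum>n. c n * (w (x n) * tf_deriv k \<psi> (x n)))" for \<psi>
  have "T \<in> distributions"
  proof (rule distributionsI)
    show "linear T"
    proof (rule linearI)
      show "T (\<phi> + \<psi>) = T \<phi> + T \<psi>" for \<phi> \<psi>
        unfolding T_def suminf_add[OF summable_rabs_cancel[OF summ] summable_rabs_cancel[OF summ]]
        by (simp add: tf_deriv_add algebra_simps)
      show "T (r *\<^sub>R \<psi>) = r *\<^sub>R T \<psi>" for r \<psi>
        using suminf_mult[OF summable_rabs_cancel[OF summ], of r \<psi>]
        by (simp add: T_def tf_deriv_scaleR mult_ac)
    qed
    fix R :: real
    obtain C where C: "C \<ge> 0" "\<And>\<psi> b. \<psi> \<in> supported_in {-R..R} \<Longrightarrow> (\<forall>x. \<bar>tf_deriv k \<psi> x\<bar> \<le> b) \<Longrightarrow>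
      (\<forall>s. \<bar>w s * tf_deriv k \<psi> s\<bar> \<le> C * b)" using bd by metis
    have "\<bar>T \<psi>\<bar> \<le> (suminf (\<lambda>n. \<bar>c n\<bar>) * C) * b"
      if \<psi>: "\<psi> \<in> supported_in {-R..R}" and b: "\<forall>x. \<bar>tf_deriv k \<psi> x\<bar> \<le> b" for \<psi> b
    proof -
      have "\<bar>T \<psi>\<bar> \<le> (\<Sum>n. \<bar>c n * (w (x n) * tf_deriv k \<psi> (x n))\<bar>)"
        unfolding T_def by (rule summable_rabs[OF summ])
      also have "\<dots> \<le> (\<Sum>n. \<bar>c n\<bar> * (C * b))"
        using le[OF C(2)[OF \<psi> b]] summ c by (intro suminf_le summable_mult2) auto
      also have "\<dots> = suminf (\<lambda>n. \<bar>c n\<bar>) * (C * b)" using suminf_mult2[OF c] by simp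
      finally show ?thesis by simp
    qed
    then show "\<exists>N C. \<forall>\<psi>\<in>supported_in {-R..R}. \<forall>b.
        (\<forall>k\<le>N. \<forall>x. \<bar>tf_deriv k \<psi> x\<bar> \<le> b) \<longrightarrow> \<bar>T \<psi>\<bar> \<le> C * b"
      by (intro exI[of _ k] exI[of _ "suminf (\<lambda>n. \<bar>c n\<bar>) * C"]) auto
  qed
  then have "bounded (T ` B)" using B by (simp add: weakly_bounded_def)
  then show "\<exists>M. \<forall>\<psi>\<in>B. \<bar>\<Sum>n. c n * (w (x n) * tf_deriv k \<psi> (x n))\<bar> \<le> M"
  proof -
    obtain M where "\<And>\<psi>. \<psi> \<in> B \<Longrightarrow> \<bar>T \<psi>\<bar> \<le> M"
      using \<open>bounded (T ` B)\<close> unfolding bounded_iff real_norm_def by blast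
    then show ?thesis unfolding T_def by blast
  qed
qed

lemma weakly_bounded_imp_bounded:
  assumes "weakly_bounded B"
  obtains M where "M > 0" "\<And>\<psi> s. \<psi> \<in> B \<Longrightarrow> \<bar>tf_deriv k \<psi> s\<bar> \<le> M"
proof -
  obtain M where M: "\<forall>\<psi>\<in>B. \<forall>s. \<bar>1 * tf_deriv k \<psi> s\<bar> \<le> M"
    using weakly_bounded_weighted[OF assms, of "\<lambda>_. 1" k] by auto
  show ?thesis
  proof
    show "max M 1 > 0" by simp
    show "\<bar>tf_deriv k \<psi> s\<bar> \<le> max M 1" if "\<psi> \<in> B" for \<psi> s
      using M[rule_format, OF that, of s] by simp
  qed
qed

text \<open>If the supports were not uniformly bounded, one could choose \<open>\<psi>\<^sub>n \<in> B\<close> and \<open>x\<^sub>n\<close> with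
  \<open>\<bar>x\<^sub>n\<bar> > n\<close> and \<open>\<psi>\<^sub>n(x\<^sub>n) \<noteq> 0\<close>; the weight below is locally bounded and at least
  \<open>n / \<bar>\<psi>\<^sub>n(x\<^sub>n)\<bar>\<close> at \<open>x\<^sub>n\<close>.\<close>

lemma weakly_bounded_imp_supported:
  assumes B: "weakly_bounded B"
  obtains R where "R > 0" "B \<subseteq> supported_in {-R..R}"
proof (rule ccontr)
  assume not: "\<not> thesis"
  have "\<exists>\<psi>\<in>B. \<exists>x. \<bar>x\<bar> > real n \<and> tf_apply \<psi> x \<noteq> 0" for n
  proof (rule ccontr)
    assume *: "\<not> ?thesis"
    have "B \<subseteq> supported_in {- (real n + 1)..real n + 1}"
    proof
      fix \<psi> assume "\<psi> \<in> B"
      with * have "tf_apply \<psi> x = 0" if "x \<notin> {- (real n + 1)..real n + 1}" for x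
        using that by (force simp: not_less)
      then show "\<psi> \<in> supported_in {- (real n + 1)..real n + 1}"
        by (simp add: supported_in_iff)
    qed
    with not that[of "real n + 1"] show False by simp
  qed
  then obtain \<psi> x where \<psi>: "\<And>n. \<psi> n \<in> B" and x: "\<And>n. \<bar>x n\<bar> > real n" "\<And>n. tf_apply (\<psi> n) (x n) \<noteq> 0"
    by metis
  define a where "a n = real n / \<bar>tf_apply (\<psi> n) (x n)\<bar>" for n
  \<comment> \<open>The points \<open>x n\<close> may coincide, hence the sum. It is finite because
    \<open>\<bar>x n\<bar> > real n\<close> leaves only finitely many indices over a bounded
    set.\<close>
  define w where "w s = (\<Sum>n | x n = s. a n)" for s
  have a: "a n \<ge> 0" for n by (simp add: a_def)
  have fin: "finite {n. \<bar>x n\<bar> \<le> R}" for R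
  proof (rule finite_subset)
    show "{n. \<bar>x n\<bar> \<le> R} \<subseteq> {..nat \<lceil>R\<rceil>}"
    proof
      fix n assume "n \<in> {n. \<bar>x n\<bar> \<le> R}"
      then have "real n \<le> R" using x(1)[of n] by simp
      then show "n \<in> {..nat \<lceil>R\<rceil>}" by (simp add: le_nat_iff) linarith
    qed
  qed simp
  have fin': "finite {n. x n = s}" for s
    by (rule finite_subset[OF _ fin[of "\<bar>s\<bar>"]]) auto
  have "\<bar>w s\<bar> \<le> (\<Sum>n | \<bar>x n\<bar> \<le> R. a n)" if "\<bar>s\<bar> \<le> R" for s R
  proof -
    have "w s \<ge> 0" unfolding w_def by (intro sum_nonneg a)
    moreover have "w s \<le> (\<Sum>n | \<bar>x n\<bar> \<le> R. a n)"
      unfolding w_def using that by (intro sum_mono2 fin a) auto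
    ultimately show ?thesis by simp
  qed
  then obtain M where M: "\<And>\<eta> s. \<eta> \<in> B \<Longrightarrow> \<bar>w s * tf_deriv 0 \<eta> s\<bar> \<le> M"
    using weakly_bounded_weighted[OF B, of w 0] by metis
  have "real n \<le> M" for n
  proof -
    have "a n \<le> w (x n)"
      unfolding w_def by (rule member_le_sum) (use a fin' in auto)
    then have "a n * \<bar>tf_apply (\<psi> n) (x n)\<bar> \<le> \<bar>w (x n)\<bar> * \<bar>tf_apply (\<psi> n) (x n)\<bar>"
      by (intro mult_right_mono) auto
    then show ?thesis
      using M[OF \<psi>[of n], of "x n"] x(2)[of n] by (simp add: a_def abs_mult)
  qed
  then show False using reals_Archimedean2[of M] by (meson not_less)
qed

lemma tf_deriv_lipschitz:
  assumes "\<And>s. \<bar>tf_deriv (Suc k) \<psi> s\<bar> \<le> M"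
  shows "\<bar>tf_deriv k \<psi> s - tf_deriv k \<psi> s'\<bar> \<le> M * \<bar>s - s'\<bar>"
  using field_differentiable_bound[of UNIV "tf_deriv k \<psi>" "tf_deriv (Suc k) \<psi>" M s s']
    tf_deriv_DERIV[of k \<psi>] assms by simp

text \<open>The sequence and its limit form a weakly bounded set, hence share a compact support and
  a Lipschitz constant for the \<open>k\<close>-th derivatives. Convergence on a finite net, seen by
  testing with derivatives of delta, then becomes uniform.\<close>

lemma weakly_convergent_imp_uniform_limit:
  assumes lim: "\<And>T. T \<in> distributions \<Longrightarrow> (\<lambda>n. T (\<psi> n)) \<longlonglongrightarrow> T \<phi>"
  shows "uniform_limit UNIV (\<lambda>n. tf_deriv k (\<psi> n)) (tf_deriv k \<phi>) sequentially"
proof (rule uniform_limitI)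
  fix e :: real assume e: "e > 0"
  have B: "weakly_bounded (insert \<phi> (range \<psi>))"
    unfolding weakly_bounded_def
  proof
    fix T assume "T \<in> distributions"
    then have "bounded (range (\<lambda>n. T (\<psi> n)))" using lim convergent_imp_bounded by blast
    then show "bounded (T ` insert \<phi> (range \<psi>))" by (simp add: image_image)
  qed
  obtain M where M: "M > 0" "\<And>\<eta> s. \<eta> \<in> insert \<phi> (range \<psi>) \<Longrightarrow> \<bar>tf_deriv (Suc k) \<eta> s\<bar> \<le> M"
    using weakly_bounded_imp_bounded[OF B] by blast
  obtain R where R: "R > 0" "insert \<phi> (range \<psi>) \<subseteq> supported_in {-R..R}"
    using weakly_bounded_imp_supported[OF B] by blast
  \<comment> \<open>Moving to a net point costs less than \<open>e / 3\<close> for each of the two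
    functions, which leaves \<open>e / 3\<close> for their distance there.\<close>
  define r where "r = e / (3 * M)"
  have r: "r > 0" using e M by (simp add: r_def)
  obtain F where F: "finite F" "{-R..R} \<subseteq> (\<Union>x\<in>F. ball x r)"
    using compactE_image[of "{-R..R}" "{-R..R}" "\<lambda>x. ball x r"] r
    by (metis UN_I centre_in_ball compact_Icc open_ball subsetI)
  have "eventually (\<lambda>n. \<forall>x\<in>F. dist (tf_deriv k (\<psi> n) x) (tf_deriv k \<phi> x) < e / 3) sequentially"
    using e by (intro eventually_ball_finite F ballI tendstoD[OF lim[OF distribution_tf_deriv]]) auto
  then show "eventually (\<lambda>n. \<forall>s\<in>UNIV. dist (tf_deriv k (\<psi> n) s) (tf_deriv k \<phi> s) < e) sequentially"
  proof (rule eventually_mono, intro ballI)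
    fix n s assume n: "\<forall>x\<in>F. dist (tf_deriv k (\<psi> n) x) (tf_deriv k \<phi> x) < e / 3"
    show "dist (tf_deriv k (\<psi> n) s) (tf_deriv k \<phi> s) < e"
    proof (cases "s \<in> {-R..R}")
      case True
      then obtain x where x: "x \<in> F" "\<bar>s - x\<bar> < r"
        using F(2) by (force simp: dist_real_def abs_minus_commute)
      have lip: "\<bar>tf_deriv k \<eta> s - tf_deriv k \<eta> x\<bar> < e / 3" if "\<eta> \<in> insert \<phi> (range \<psi>)" for \<eta>
      proof -
        have "\<bar>tf_deriv k \<eta> s - tf_deriv k \<eta> x\<bar> \<le> M * \<bar>s - x\<bar>"
          using tf_deriv_lipschitz M(2)[OF that] .
        also have "\<dots> < M * r" using x M(1) by (intro mult_strict_left_mono)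
        also have "\<dots> = e / 3" using M(1) by (simp add: r_def)
        finally show ?thesis .
      qed
      have "\<bar>tf_deriv k (\<psi> n) x - tf_deriv k \<phi> x\<bar> < e / 3"
        using n x(1) by (auto simp: dist_real_def)
      then show ?thesis
        using lip[of \<phi>, OF insertI1] lip[of "\<psi> n", OF insertI2[OF rangeI]]
        unfolding dist_real_def by linarith
    next
      case False
      then have "tf_deriv k \<eta> s = 0" if "\<eta> \<in> insert \<phi> (range \<psi>)" for \<eta>
        using R(2) that by (intro tf_deriv_eq_0[of _ "{-R..R}"]) auto
      then show ?thesis using e by simp
    qed
  qed
qed

section \<open>Differentiation in the space of test functions\<close>

lift_definition tf_D :: "test_fun \<Rightarrow> test_fun" is deriv
proof -
  fix f :: "real \<Rightarrow> real" assume f: "test_function f"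
  have "closure {x. deriv f x \<noteq> 0} \<subseteq> closure {x. f x \<noteq> 0}"
  proof (rule closure_minimal)
    have "deriv f x = 0" if "x \<notin> closure {x. f x \<noteq> 0}" for x
    proof -
      have "(deriv ^^ 1) f x = (deriv ^^ 1) (\<lambda>x. 0) x"
      proof (rule higher_deriv_cong_open)
        show "f y = 0" if "y \<in> - closure {x. f x \<noteq> 0}" for y
          using that closure_subset[of "{x. f x \<noteq> 0}"] by blast
      qed (use that in auto)
      then show ?thesis by simp
    qed
    then show "{x. deriv f x \<noteq> 0} \<subseteq> closure {x. f x \<noteq> 0}" by auto
  qed simp
  moreover have "compact (closure {x. f x \<noteq> 0})" using f unfolding test_function_def by blast
  ultimately have "compact (closure {x. deriv f x \<noteq> 0})"
    using closed_closure compact_Int_closed by (metis inf.absorb_iff2)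
  moreover have "(deriv ^^ k) (deriv f) differentiable (at x)" for k x
    using f unfolding test_function_def by (metis funpow_Suc_right comp_apply)
  ultimately show "test_function (deriv f)" unfolding test_function_def by blast
qed

lemma tf_deriv_D: "tf_deriv k (tf_D \<phi>) = tf_deriv (Suc k) \<phi>"
  by (simp add: tf_D.rep_eq funpow_Suc_right del: funpow.simps)

lemma linear_tf_D: "linear tf_D"
proof (rule linearI)
  show "tf_D (\<phi> + \<psi>) = tf_D \<phi> + tf_D \<psi>" for \<phi> \<psi>
    unfolding tf_apply_inject [symmetric]
    using tf_deriv_D[of 0] tf_deriv_add[of 1] by (auto simp: plus_test_fun.rep_eq)
  show "tf_D (c *\<^sub>R \<phi>) = c *\<^sub>R tf_D \<phi>" for c \<phi>
    unfolding tf_apply_inject [symmetric]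
    using tf_deriv_D[of 0] tf_deriv_scaleR[of 1] by (auto simp: scaleR_test_fun.rep_eq)
qed

lemma supported_in_tf_D: "\<phi> \<in> supported_in K \<Longrightarrow> closed K \<Longrightarrow> tf_D \<phi> \<in> supported_in K"
  using tf_deriv_eq_0[of \<phi> K _ 1] by (subst supported_in_iff) (simp_all add: tf_D.rep_eq)

text \<open>Differentiation does not enlarge supports and shifts orders by one, so closeness up to
  order \<open>Suc N\<close> gives closeness of the derivatives up to order
  \<open>N\<close>.\<close>

lemma basic_nhd_vimage_tf_D:
  assumes W: "basic_nhd W"
  shows "basic_nhd (tf_D -` W)"
  unfolding basic_nhd_def
proof (intro conjI allI impI)
  interpret linear tf_D by (rule linear_tf_D)
  show "tf_D -` W \<noteq> {}" using basic_nhd_zero[OF W] zero by (metis empty_iff vimageI)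
  show "convex (tf_D -` W)"
    using W linear_tf_D by (intro convex_linear_vimage) (auto simp: basic_nhd_def)
  show "c *\<^sub>R \<phi> \<in> tf_D -` W" if "\<bar>c\<bar> \<le> 1" "\<phi> \<in> tf_D -` W" for c \<phi>
    using that W by (simp add: scale basic_nhd_def)
  fix K :: "real set" assume K: "compact K"
  then have cK: "closed K" by (rule compact_imp_closed)
  have op: "open_in_supported K (W \<inter> supported_in K)" using W K by (simp add: basic_nhd_def)
  show "open_in_supported K (tf_D -` W \<inter> supported_in K)"
    unfolding open_in_supported_def
  proof (intro conjI ballI)
    fix \<phi> assume "\<phi> \<in> tf_D -` W \<inter> supported_in K"
    then have "tf_D \<phi> \<in> W \<inter> supported_in K" using supported_in_tf_D cK by auto
    then obtain N e where e: "e > 0" "\<And>\<psi>. \<psi> \<in> supported_in K \<Longrightarrow>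
        (\<forall>k\<le>N. \<forall>x. \<bar>tf_deriv k (\<psi> - tf_D \<phi>) x\<bar> < e) \<Longrightarrow> \<psi> \<in> W \<inter> supported_in K"
      using op unfolding open_in_supported_def by metis
    have "\<psi> \<in> tf_D -` W \<inter> supported_in K"
      if \<psi>: "\<psi> \<in> supported_in K" and s: "\<forall>k\<le>Suc N. \<forall>x. \<bar>tf_deriv k (\<psi> - \<phi>) x\<bar> < e" for \<psi>
    proof -
      have "tf_D \<psi> \<in> W \<inter> supported_in K"
      proof (rule e(2))
        show "tf_D \<psi> \<in> supported_in K" using \<psi> cK by (rule supported_in_tf_D)
        show "\<forall>k\<le>N. \<forall>x. \<bar>tf_deriv k (tf_D \<psi> - tf_D \<phi>) x\<bar> < e"
          unfolding diff[symmetric] tf_deriv_D using s by (metis Suc_le_mono)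
      qed
      with \<psi> show ?thesis by auto
    qed
    with e(1) show "\<exists>N. \<exists>\<epsilon>>0. \<forall>\<psi>\<in>supported_in K.
        (\<forall>k\<le>N. \<forall>x. \<bar>tf_deriv k (\<psi> - \<phi>) x\<bar> < \<epsilon>) \<longrightarrow> \<psi> \<in> tf_D -` W \<inter> supported_in K"
      by blast
  qed auto
qed

lemma continuous_on_tf_D: "continuous_on UNIV tf_D"
proof -
  interpret linear tf_D by (rule linear_tf_D)
  have "open (tf_D -` G)" if "open G" for G
    unfolding open_test_fun_def
  proof
    fix \<phi> assume "\<phi> \<in> tf_D -` G"
    then obtain W where W: "basic_nhd W" "(\<lambda>\<psi>. tf_D \<phi> + \<psi>) ` W \<subseteq> G"
      using \<open>open G\<close> unfolding open_test_fun_def by blast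
    then have "(\<lambda>\<psi>. \<phi> + \<psi>) ` (tf_D -` W) \<subseteq> tf_D -` G" by (auto simp: add)
    with basic_nhd_vimage_tf_D[OF W(1)]
    show "\<exists>W. basic_nhd W \<and> (\<lambda>\<psi>. \<phi> + \<psi>) ` W \<subseteq> tf_D -` G" by blast
  qed
  then show ?thesis by (simp add: continuous_on_open_vimage)
qed

text \<open>\<open>T \<circ> tf_D\<close> is minus the distributional derivative of
  \<open>T\<close>. As plots are defined by testing, differentiation therefore maps plots to
  plots.\<close>

lemma distribution_comp_tf_D: "T \<in> distributions \<Longrightarrow> T \<circ> tf_D \<in> distributions"
  using linear_compose[OF linear_tf_D, of T] continuous_on_compose2[of UNIV T, OF _ continuous_on_tf_D]
  unfolding distributions_def comp_def by auto

lemma tf_D_plot: "p \<in> plots test_fun_space n U \<Longrightarrow> tf_D \<circ> p \<in> plots test_fun_space n U"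
  using distribution_comp_tf_D by (auto simp: test_fun_space_def comp_assoc [symmetric])

text \<open>Turns a pointwise limit, given with all its successive derivatives, back into an element
  of \<open>test_fun\<close>.\<close>

lemma tf_deriv_Abs_test_fun:
  assumes der: "\<And>k s. (g k has_real_derivative g (Suc k) s) (at s)"
    and supp: "\<And>s. s \<notin> {-R..R} \<Longrightarrow> g 0 s = 0"
  shows "tf_deriv k (Abs_test_fun (g 0)) = g k"
proof -
  have g: "(deriv ^^ k) (g 0) = g k" for k
  proof (induction k)
    case (Suc k)
    then show ?case using DERIV_imp_deriv[OF der] by auto
  qed simp
  have "compact (closure {x. g 0 x \<noteq> 0})"
    unfolding compact_closure
  proof (rule bounded_subset)
    show "{x. g 0 x \<noteq> 0} \<subseteq> {-R..R}" using supp by blast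
  qed simp
  then have "test_function (g 0)"
    unfolding test_function_def g real_differentiable_def using der by blast
  then show ?thesis using g by (simp add: Abs_test_fun_inverse)
qed

text \<open>The differences of two difference quotients \<open>q u\<close> and \<open>q u'\<close>, divided by \<open>\<bar>u\<bar> + \<bar>u'\<bar>\<close>, form a
  weakly bounded set. Hence the difference quotients and all their derivatives are uniformly Cauchy
  as \<open>u \<rightarrow> 0\<close>.\<close>

lemma weak_derivative:
  fixes c :: "real \<Rightarrow> test_fun"
  defines "q \<equiv> \<lambda>u. (1 / u) *\<^sub>R (c u - c 0)"
  assumes \<delta>: "\<delta> > 0"
    and rem: "\<And>T. T \<in> distributions \<Longrightarrow>
      \<exists>M. \<forall>u. \<bar>u\<bar> \<le> \<delta> \<longrightarrow> \<bar>T (c u) - T (c 0) - u * d T\<bar> \<le> M * u\<^sup>2"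
  obtains \<eta> C where "\<And>T. T \<in> distributions \<Longrightarrow> T \<eta> = d T"
    "\<And>u s. 0 < \<bar>u\<bar> \<Longrightarrow> \<bar>u\<bar> \<le> \<delta> \<Longrightarrow> \<bar>tf_deriv 0 (q u - \<eta>) s\<bar> \<le> C * \<bar>u\<bar>"
proof -
  \<comment> \<open>Dividing the quadratic remainder by \<open>u\<close> leaves an error linear in
    \<open>u\<close>. This rate is what makes the set \<open>Q\<close> below weakly bounded.\<close>
  have q: "\<exists>M\<ge>0. \<forall>u. 0 < \<bar>u\<bar> \<longrightarrow> \<bar>u\<bar> \<le> \<delta> \<longrightarrow> \<bar>T (q u) - d T\<bar> \<le> M * \<bar>u\<bar>" if T: "T \<in> distributions" for T
  proof -
    interpret linear T using T by (simp add: distributions_def)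
    obtain M where M: "\<And>u. \<bar>u\<bar> \<le> \<delta> \<Longrightarrow> \<bar>T (c u) - T (c 0) - u * d T\<bar> \<le> M * u\<^sup>2" using rem[OF T] by blast
    have "\<bar>T (q u) - d T\<bar> \<le> \<bar>M\<bar> * \<bar>u\<bar>" if u: "0 < \<bar>u\<bar>" "\<bar>u\<bar> \<le> \<delta>" for u
    proof -
      have "\<bar>u\<bar> * \<bar>T (q u) - d T\<bar> = \<bar>u * (T (q u) - d T)\<bar>" by (simp add: abs_mult)
      also have "u * (T (q u) - d T) = T (c u) - T (c 0) - u * d T"
        using u by (simp add: q_def scale diff field_simps)
      also have "\<bar>\<dots>\<bar> \<le> M * u\<^sup>2" using M u by blast
      also have "\<dots> \<le> \<bar>M\<bar> * u\<^sup>2" by (intro mult_right_mono) auto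
      also have "\<dots> = \<bar>u\<bar> * (\<bar>M\<bar> * \<bar>u\<bar>)" by (simp add: power2_eq_square)
      finally show ?thesis using u by (simp only: mult_le_cancel_left_pos)
    qed
    then show ?thesis by (intro exI[of _ "\<bar>M\<bar>"]) auto
  qed
  \<comment> \<open>The quotients themselves yield the common support; the convergence of their
    derivatives will come from \<open>Q\<close>.\<close>
  have "weakly_bounded (q ` {u. 0 < \<bar>u\<bar> \<and> \<bar>u\<bar> \<le> \<delta>})"
    unfolding weakly_bounded_def
  proof
    fix T assume T: "T \<in> distributions"
    obtain M where M: "M \<ge> 0" "\<And>u. 0 < \<bar>u\<bar> \<Longrightarrow> \<bar>u\<bar> \<le> \<delta> \<Longrightarrow> \<bar>T (q u) - d T\<bar> \<le> M * \<bar>u\<bar>" using q[OF T] by blast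
    have "\<bar>T (q u)\<bar> \<le> \<bar>d T\<bar> + M * \<delta>" if u: "0 < \<bar>u\<bar>" "\<bar>u\<bar> \<le> \<delta>" for u
      using M(2)[OF u] mult_left_mono[OF u(2) M(1)] by linarith
    then show "bounded (T ` q ` {u. 0 < \<bar>u\<bar> \<and> \<bar>u\<bar> \<le> \<delta>})"
      unfolding bounded_iff by (intro exI[of _ "\<bar>d T\<bar> + M * \<delta>"]) auto
  qed
  then obtain R where R: "R > 0" "q ` {u. 0 < \<bar>u\<bar> \<and> \<bar>u\<bar> \<le> \<delta>} \<subseteq> supported_in {-R..R}"
    using weakly_bounded_imp_supported by blast
  define Q where "Q = {(1 / (\<bar>u\<bar> + \<bar>u'\<bar>)) *\<^sub>R (q u - q u') | u u'. 0 < \<bar>u\<bar> \<and> \<bar>u\<bar> \<le> \<delta> \<and> 0 < \<bar>u'\<bar> \<and> \<bar>u'\<bar> \<le> \<delta>}"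
  have Q: "weakly_bounded Q"
    unfolding weakly_bounded_def
  proof
    fix T assume T: "T \<in> distributions"
    interpret linear T using T by (simp add: distributions_def)
    obtain M where M: "M \<ge> 0" "\<And>u. 0 < \<bar>u\<bar> \<Longrightarrow> \<bar>u\<bar> \<le> \<delta> \<Longrightarrow> \<bar>T (q u) - d T\<bar> \<le> M * \<bar>u\<bar>" using q[OF T] by blast
    have "\<bar>T \<psi>\<bar> \<le> M" if \<psi>Q: "\<psi> \<in> Q" for \<psi>
    proof -
      obtain u u' where u: "0 < \<bar>u\<bar>" "\<bar>u\<bar> \<le> \<delta>" and u': "0 < \<bar>u'\<bar>" "\<bar>u'\<bar> \<le> \<delta>"
        and \<psi>: "\<psi> = (1 / (\<bar>u\<bar> + \<bar>u'\<bar>)) *\<^sub>R (q u - q u')"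
        using \<psi>Q unfolding Q_def by blast
      have "\<bar>T (q u) - T (q u')\<bar> \<le> M * (\<bar>u\<bar> + \<bar>u'\<bar>)"
        using M(2)[OF u] M(2)[OF u'] unfolding distrib_left by linarith
      moreover have "\<bar>T \<psi>\<bar> = \<bar>T (q u) - T (q u')\<bar> / (\<bar>u\<bar> + \<bar>u'\<bar>)"
        by (simp add: \<psi> scale diff abs_mult)
      moreover have "\<bar>u\<bar> + \<bar>u'\<bar> > 0" using u u' by linarith
      ultimately show ?thesis by (simp add: pos_divide_le_eq)
    qed
    then show "bounded (T ` Q)" unfolding bounded_iff by auto
  qed
  \<comment> \<open>The candidate for the \<open>k\<close>-th derivative of the limit at
    \<open>s\<close>, found by testing with a derivative of delta.\<close>
  define g where "g k s = d (\<lambda>\<psi>. tf_deriv k \<psi> s)" for k s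
  define u where "u n = \<delta> / real (Suc n)" for n
  have u: "0 < \<bar>u n\<bar>" "\<bar>u n\<bar> \<le> \<delta>" for n
    using \<delta> by (auto simp: u_def field_simps)
  have "u \<longlonglongrightarrow> 0" unfolding u_def by (rule LIMSEQ_Suc[OF lim_const_over_n])
  then have u0: "(\<lambda>n. \<bar>u n\<bar>) \<longlonglongrightarrow> 0" by (rule tendsto_rabs_zero)
  have Tlim: "(\<lambda>n. T (q (u n))) \<longlonglongrightarrow> d T" if T: "T \<in> distributions" for T
  proof -
    obtain M where M: "M \<ge> 0" "\<And>u. 0 < \<bar>u\<bar> \<Longrightarrow> \<bar>u\<bar> \<le> \<delta> \<Longrightarrow> \<bar>T (q u) - d T\<bar> \<le> M * \<bar>u\<bar>" using q[OF T] by blast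
    have "(\<lambda>n. T (q (u n)) - d T) \<longlonglongrightarrow> 0"
    proof (rule Lim_null_comparison)
      show "eventually (\<lambda>n. norm (T (q (u n)) - d T) \<le> M * \<bar>u n\<bar>) sequentially"
        using M(2) u by (auto intro!: always_eventually)
      show "(\<lambda>n. M * \<bar>u n\<bar>) \<longlonglongrightarrow> 0" using tendsto_mult_left_zero[OF u0] tendsto_mult_right_zero[OF u0] by blast
    qed
    then show ?thesis by (simp add: Lim_null[symmetric])
  qed
  have glim: "(\<lambda>n. tf_deriv k (q (u n)) s) \<longlonglongrightarrow> g k s" for k s
    unfolding g_def by (rule Tlim[OF distribution_tf_deriv])
  have gest: "\<exists>C>0. \<forall>u s. 0 < \<bar>u\<bar> \<longrightarrow> \<bar>u\<bar> \<le> \<delta> \<longrightarrow> \<bar>tf_deriv k (q u) s - g k s\<bar> \<le> C * \<bar>u\<bar>" for k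
  proof -
    obtain C where C: "C > 0" "\<And>\<psi> s. \<psi> \<in> Q \<Longrightarrow> \<bar>tf_deriv k \<psi> s\<bar> \<le> C"
      using weakly_bounded_imp_bounded[OF Q] by blast
    \<comment> \<open>In the bound on \<open>Q\<close> one quotient stays fixed at \<open>x\<close>
      while the other runs through \<open>q (u n)\<close>; the limit turns the Cauchy estimate into
      a rate of convergence.\<close>
    have "\<bar>tf_deriv k (q x) s - g k s\<bar> \<le> C * \<bar>x\<bar>" if x: "0 < \<bar>x\<bar>" "\<bar>x\<bar> \<le> \<delta>" for x s
    proof (rule LIMSEQ_le)
      show "(\<lambda>n. \<bar>tf_deriv k (q x) s - tf_deriv k (q (u n)) s\<bar>) \<longlonglongrightarrow> \<bar>tf_deriv k (q x) s - g k s\<bar>"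
        by (intro tendsto_intros glim)
      show "(\<lambda>n. C * (\<bar>x\<bar> + \<bar>u n\<bar>)) \<longlonglongrightarrow> C * \<bar>x\<bar>"
        using tendsto_mult_left[OF tendsto_add[OF tendsto_const u0], of C "\<bar>x\<bar>"] by simp
      have "\<bar>tf_deriv k (q x) s - tf_deriv k (q (u n)) s\<bar> \<le> C * (\<bar>x\<bar> + \<bar>u n\<bar>)" for n
      proof -
        have "(1 / (\<bar>x\<bar> + \<bar>u n\<bar>)) *\<^sub>R (q x - q (u n)) \<in> Q"
          unfolding Q_def using x u by blast
        from C(2)[OF this, of s]
        have "\<bar>tf_deriv k (q x) s - tf_deriv k (q (u n)) s\<bar> / (\<bar>x\<bar> + \<bar>u n\<bar>) \<le> C"
          by (simp add: tf_deriv_scaleR tf_deriv_diff abs_mult)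
        moreover have "\<bar>x\<bar> + \<bar>u n\<bar> > 0" using x u[of n] by linarith
        ultimately show ?thesis by (simp add: pos_divide_le_eq)
      qed
      then show "\<exists>N. \<forall>n\<ge>N. \<bar>tf_deriv k (q x) s - tf_deriv k (q (u n)) s\<bar> \<le> C * (\<bar>x\<bar> + \<bar>u n\<bar>)" by blast
    qed
    with C(1) show ?thesis by blast
  qed
  have unif: "uniform_limit UNIV (\<lambda>n. tf_deriv k (q (u n))) (g k) sequentially" for k
  proof (rule uniform_limitI)
    fix e :: real assume "e > 0"
    obtain C where C: "C > 0" "\<And>u s. 0 < \<bar>u\<bar> \<Longrightarrow> \<bar>u\<bar> \<le> \<delta> \<Longrightarrow> \<bar>tf_deriv k (q u) s - g k s\<bar> \<le> C * \<bar>u\<bar>"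
      using gest by blast
    have "eventually (\<lambda>n. \<bar>u n\<bar> < e / C) sequentially"
      using order_tendstoD(2)[OF u0, of "e / C"] \<open>e > 0\<close> C(1) by simp
    then show "eventually (\<lambda>n. \<forall>s\<in>UNIV. dist (tf_deriv k (q (u n)) s) (g k s) < e) sequentially"
    proof eventually_elim
      case (elim n)
      then have "C * \<bar>u n\<bar> < e" using C(1) by (simp add: pos_less_divide_eq mult.commute)
      then show ?case using C(2)[OF u[of n]] unfolding dist_real_def by (meson le_less_trans)
    qed
  qed
  \<comment> \<open>Uniform convergence of the next derivatives permits differentiation of the
    limit, and uniqueness of limits identifies \<open>G\<close> with \<open>g k\<close>.\<close>
  have der: "(g k has_real_derivative g (Suc k) s) (at s)" for k s
  proof -
    have "\<exists>G. \<forall>x\<in>UNIV. (\<lambda>n. tf_deriv k (q (u n)) x) \<longlonglongrightarrow> G x \<and> (G has_derivative (\<lambda>h. g (Suc k) x * h)) (at x within UNIV)"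
    proof (rule has_derivative_sequence)
      show "(tf_deriv k (q (u n)) has_derivative (\<lambda>h. tf_deriv (Suc k) (q (u n)) x * h)) (at x within UNIV)" for n x
        using tf_deriv_DERIV[of k "q (u n)" x] by (simp only: has_field_derivative_def)
      fix e :: real assume "e > 0"
      show "eventually (\<lambda>n. \<forall>x\<in>UNIV. \<forall>h. norm (tf_deriv (Suc k) (q (u n)) x * h - g (Suc k) x * h) \<le> e * norm h) sequentially"
        using uniform_limitD[OF unif[of "Suc k"] \<open>e > 0\<close>]
      proof eventually_elim
        case (elim n)
        show ?case
        proof (intro ballI allI)
          fix x h
          have "norm (tf_deriv (Suc k) (q (u n)) x * h - g (Suc k) x * h) =
              \<bar>tf_deriv (Suc k) (q (u n)) x - g (Suc k) x\<bar> * norm h"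
            by (simp only: left_diff_distrib[symmetric] norm_mult real_norm_def abs_mult)
          also have "\<dots> \<le> e * norm h"
            using elim by (intro mult_right_mono) (auto simp: dist_real_def intro: less_imp_le)
          finally show "norm (tf_deriv (Suc k) (q (u n)) x * h - g (Suc k) x * h) \<le> e * norm h" .
        qed
      qed
    qed (auto intro: glim)
    then obtain G where G: "\<And>x. (\<lambda>n. tf_deriv k (q (u n)) x) \<longlonglongrightarrow> G x"
      "\<And>x. (G has_derivative (\<lambda>h. g (Suc k) x * h)) (at x)" by auto
    have "G = g k" using LIMSEQ_unique[OF G(1) glim] by blast
    with G(2) show ?thesis by (simp only: has_field_derivative_def)
  qed
  have supp: "g 0 s = 0" if "s \<notin> {-R..R}" for s
  proof -
    have "tf_deriv 0 (q (u n)) s = 0" for n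
      using R(2) u[of n] that by (intro tf_deriv_eq_0[of _ "{-R..R}"]) auto
    then show ?thesis using glim[of 0 s] LIMSEQ_unique[OF _ tendsto_const] by simp
  qed
  define \<eta> where "\<eta> = Abs_test_fun (g 0)"
  have \<eta>: "tf_deriv k \<eta> = g k" for k
    unfolding \<eta>_def by (rule tf_deriv_Abs_test_fun[OF der supp])
  have "\<eta> \<in> supported_in {-R..R}"
    using \<eta>[of 0] supp by (simp add: supported_in_iff)
  moreover have "q (u n) \<in> supported_in {-R..R}" for n using R(2) u[of n] by auto
  \<comment> \<open>Convergence of all derivatives with a common support lets every distribution
    pass to the limit, not just those that define \<open>g\<close>.\<close>
  ultimately have "(\<lambda>n. T (q (u n))) \<longlonglongrightarrow> T \<eta>" if "T \<in> distributions" for T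
    using unif that by (intro distribution_tendsto[of T "{-R..R}"]) (simp_all only: \<eta> compact_Icc)
  then have "T \<eta> = d T" if "T \<in> distributions" for T
    using that LIMSEQ_unique[OF _ Tlim[OF that]] by blast
  moreover obtain C where "\<And>u s. 0 < \<bar>u\<bar> \<Longrightarrow> \<bar>u\<bar> \<le> \<delta> \<Longrightarrow> \<bar>tf_deriv 0 (q u) s - g 0 s\<bar> \<le> C * \<bar>u\<bar>"
    using gest by blast
  then have "\<And>u s. 0 < \<bar>u\<bar> \<Longrightarrow> \<bar>u\<bar> \<le> \<delta> \<Longrightarrow> \<bar>tf_deriv 0 (q u - \<eta>) s\<bar> \<le> C * \<bar>u\<bar>"
    by (simp only: tf_deriv_diff \<eta>)
  ultimately show ?thesis using that by blast
qed

section \<open>The heat kernel\<close>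

definition gauss_kernel :: "real \<Rightarrow> real \<Rightarrow> real" where
  "gauss_kernel t s = exp (- (s\<^sup>2 / (4 * t))) / sqrt (4 * pi * t)"

definition heat :: "real \<Rightarrow> test_fun \<Rightarrow> real" where
  "heat t \<phi> = (if t = 0 then tf_apply \<phi> 0 else (LINT s|lborel. gauss_kernel t s * tf_apply \<phi> s))"

text \<open>With variance \<open>2 * t\<close>, the known moments of the normal density supply total
  mass one and second moment \<open>2 * t\<close>.\<close>

lemma gauss_kernel_normal_density:
  assumes "t > 0"
  shows "gauss_kernel t s = normal_density 0 (sqrt (2 * t)) s"
  using assms by (simp add: gauss_kernel_def normal_density_def mult_ac)

lemma integral_gauss_kernel: "t > 0 \<Longrightarrow> (LINT s|lborel. gauss_kernel t s) = 1"
  by (simp add: gauss_kernel_normal_density cong: Bochner_Integration.integral_cong)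

lemma gauss_kernel_nonneg: "gauss_kernel t s \<ge> 0" if "t > 0"
  using that by (simp add: gauss_kernel_normal_density)

lemma integrable_gauss_kernel: "t > 0 \<Longrightarrow> integrable lborel (gauss_kernel t)"
  using integrable_normal_density[of "sqrt (2 * t)" 0]
  by (simp add: gauss_kernel_normal_density cong: Bochner_Integration.integrable_cong)

lemma gauss_kernel_second_moment:
  assumes "t > 0"
  shows "integrable lborel (\<lambda>s. gauss_kernel t s * s\<^sup>2)" "(LINT s|lborel. gauss_kernel t s * s\<^sup>2) = 2 * t"
  using integrable_normal_moment[of "sqrt (2 * t)" 0 2] integral_normal_moment_even[of "sqrt (2 * t)" 0 1] assms
  by (simp_all add: gauss_kernel_normal_density fact_numeral)

lemma integrable_gauss_kernel_mult:
  assumes "t > 0"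
  shows "integrable lborel (\<lambda>s. gauss_kernel t s * tf_apply \<phi> s)"
proof -
  obtain C where C: "C > 0" "\<And>s. \<bar>tf_deriv 0 \<phi> s\<bar> \<le> C" using tf_deriv_bounded by blast
  have "tf_apply \<phi> \<in> borel_measurable borel"
    using tf_deriv_continuous[of UNIV 0 \<phi>] by (simp add: borel_measurable_continuous_onI)
  then show ?thesis
    using C by (intro Bochner_Integration.integrable_bound[OF
        integrable_mult_left[OF integrable_gauss_kernel[OF assms], of C]])
      (auto simp: gauss_kernel_def[abs_def] abs_mult intro!: divide_right_mono mult_mono)
qed

lemma linear_heat:
  assumes "t \<ge> 0"
  shows "linear (heat t)"
proof (cases "t = 0")
  case False
  then have t: "t > 0" using assms by simp
  show ?thesis
  proof (rule linearI)
    show "heat t (\<phi> + \<psi>) = heat t \<phi> + heat t \<psi>" for \<phi> \<psi>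
      using t integrable_gauss_kernel_mult[OF t]
      by (simp add: heat_def plus_test_fun.rep_eq distrib_left)
    show "heat t (c *\<^sub>R \<phi>) = c *\<^sub>R heat t \<phi>" for c \<phi>
      using t by (simp add: heat_def scaleR_test_fun.rep_eq mult.left_commute)
  qed
qed (auto intro!: linearI simp: heat_def plus_test_fun.rep_eq scaleR_test_fun.rep_eq)

text \<open>The kernel is nonnegative with mass one, so averaging against it does not increase the
  supremum norm. The bound is uniform in \<open>t\<close>, which later lets time and test function
  vary together.\<close>

lemma heat_le:
  assumes t: "t \<ge> 0" and C: "\<And>s. \<bar>tf_apply \<phi> s\<bar> \<le> C"
  shows "\<bar>heat t \<phi>\<bar> \<le> C"
proof (cases "t = 0")
  case False
  then have t: "t > 0" using assms by simp
  have "\<bar>heat t \<phi>\<bar> \<le> (LINT s|lborel. \<bar>gauss_kernel t s * tf_apply \<phi> s\<bar>)"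
    using t by (simp add: heat_def integral_abs_bound)
  also have "\<dots> \<le> (LINT s|lborel. gauss_kernel t s * C)"
    using C gauss_kernel_nonneg[OF t] integrable_gauss_kernel[OF t] integrable_gauss_kernel_mult[OF t]
    by (intro integral_mono integrable_abs integrable_mult_left) (auto simp: abs_mult mult_left_mono)
  also have "\<dots> = C" using integral_gauss_kernel[OF t] by simp
  finally show ?thesis .
qed (use C in \<open>simp add: heat_def\<close>)

lemma heat_distribution:
  assumes "t \<ge> 0"
  shows "heat t \<in> distributions"
proof (rule distributionsI)
  show "\<exists>N C. \<forall>\<psi>\<in>supported_in {-R..R}. \<forall>b. (\<forall>k\<le>N. \<forall>x. \<bar>tf_deriv k \<psi> x\<bar> \<le> b) \<longrightarrow> \<bar>heat t \<psi>\<bar> \<le> C * b" for R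
    using heat_le[OF assms] by (intro exI[of _ 0] exI[of _ 1]) auto
qed (rule linear_heat[OF assms])


text \<open>\<open>\<phi>\<close> changes by at most \<open>L * \<bar>s\<bar>\<close>, and
  \<open>\<bar>s\<bar> \<le> e + s^2 / e\<close> with \<open>e = sqrt t\<close> reduces the mean of
  \<open>\<bar>s\<bar>\<close> to the mass and the second moment, which contribute \<open>e\<close>
  and \<open>2 * e\<close>. This gives continuity at time zero.\<close>

lemma heat_sub_initial_le:
  assumes t: "t > 0" and L: "\<And>s. \<bar>tf_deriv 1 \<phi> s\<bar> \<le> L"
  shows "\<bar>heat t \<phi> - heat 0 \<phi>\<bar> \<le> 3 * L * sqrt t"
proof -
  have L0: "L \<ge> 0" using L[of 0] by linarith
  define e where "e = sqrt t"
  have e: "e > 0" "e\<^sup>2 = t" using t by (auto simp: e_def)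
  have abs_le: "\<bar>s\<bar> \<le> e + s\<^sup>2 / e" for s
  proof -
    have "0 \<le> (e - \<bar>s\<bar>)\<^sup>2 + e * \<bar>s\<bar>" using e by simp
    then have "e * \<bar>s\<bar> \<le> e\<^sup>2 + s\<^sup>2" by (simp add: power2_diff)
    then show ?thesis using e by (simp add: field_simps power2_eq_square)
  qed
  have lip: "\<bar>tf_apply \<phi> s - tf_apply \<phi> 0\<bar> \<le> L * (e + s\<^sup>2 / e)" for s
  proof -
    have "\<bar>tf_apply \<phi> s - tf_apply \<phi> 0\<bar> \<le> L * \<bar>s - 0\<bar>"
      using field_differentiable_bound[of UNIV "tf_apply \<phi>" "tf_deriv 1 \<phi>" L s 0]
        tf_deriv_DERIV[of 0 \<phi>] L by simp
    also have "\<dots> \<le> L * (e + s\<^sup>2 / e)" using abs_le[of s] L0 by (intro mult_left_mono) auto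
    finally show ?thesis .
  qed
  note int = integrable_gauss_kernel_mult[OF t, of \<phi>] integrable_gauss_kernel[OF t]
    gauss_kernel_second_moment(1)[OF t]
  have eq: "gauss_kernel t s * (L * (e + s\<^sup>2 / e)) = gauss_kernel t s * (L * e) + (gauss_kernel t s * s\<^sup>2) * (L / e)" for s
    using e by (simp add: field_simps)
  have int2: "integrable lborel (\<lambda>s. gauss_kernel t s * (L * (e + s\<^sup>2 / e)))"
    unfolding eq using int by (intro Bochner_Integration.integrable_add integrable_mult_left)
  have eq3: "gauss_kernel t s * (tf_apply \<phi> s - tf_apply \<phi> 0) = gauss_kernel t s * tf_apply \<phi> s - gauss_kernel t s * tf_apply \<phi> 0" for s
    by (simp add: right_diff_distrib)
  have int3: "integrable lborel (\<lambda>s. gauss_kernel t s * (tf_apply \<phi> s - tf_apply \<phi> 0))"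
    unfolding eq3 using int by (intro Bochner_Integration.integrable_diff integrable_mult_left)
  have "heat t \<phi> - heat 0 \<phi> = (LINT s|lborel. gauss_kernel t s * (tf_apply \<phi> s - tf_apply \<phi> 0))"
    unfolding eq3 using t int integral_gauss_kernel[OF t] by (simp add: heat_def)
  also have "\<bar>\<dots>\<bar> \<le> (LINT s|lborel. \<bar>gauss_kernel t s * (tf_apply \<phi> s - tf_apply \<phi> 0)\<bar>)"
    by (rule integral_abs_bound)
  also have "\<dots> \<le> (LINT s|lborel. gauss_kernel t s * (L * (e + s\<^sup>2 / e)))"
    using lip gauss_kernel_nonneg[OF t]
    by (intro integral_mono integrable_abs int2 int3) (auto simp: abs_mult mult_left_mono)
  also have "\<dots> = L * e + 2 * t * (L / e)"
    unfolding eq using int integral_gauss_kernel[OF t] gauss_kernel_second_moment(2)[OF t] by simp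
  also have "2 * t * (L / e) = 2 * L * e" using e by (simp add: field_simps power2_eq_square)
  finally show ?thesis by (simp add: e_def)
qed

section \<open>The heat equation at positive times\<close>

definition gauss_kernel_s :: "real \<Rightarrow> real \<Rightarrow> real" where
  "gauss_kernel_s t s = - (s / (2 * t)) * gauss_kernel t s"

definition gauss_kernel_ss :: "real \<Rightarrow> real \<Rightarrow> real" where
  "gauss_kernel_ss t s = (s\<^sup>2 / (4 * t\<^sup>2) - 1 / (2 * t)) * gauss_kernel t s"

lemma DERIV_gauss_kernel_s:
  assumes "t > 0"
  shows "(gauss_kernel t has_real_derivative gauss_kernel_s t s) (at s)"
  unfolding gauss_kernel_def[abs_def] gauss_kernel_s_def using assms
  by (auto intro!: derivative_eq_intros simp: field_simps)

lemma DERIV_gauss_kernel_ss: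
  assumes "t > 0"
  shows "(gauss_kernel_s t has_real_derivative gauss_kernel_ss t s) (at s)"
proof -
  have "((\<lambda>s. - (s / (2 * t)) * gauss_kernel t s) has_real_derivative
      - (s / (2 * t)) * gauss_kernel_s t s + - (1 / (2 * t)) * gauss_kernel t s) (at s)"
    using assms by (auto intro!: derivative_eq_intros DERIV_gauss_kernel_s simp: field_simps)
  also have "- (s / (2 * t)) * gauss_kernel_s t s + - (1 / (2 * t)) * gauss_kernel t s = gauss_kernel_ss t s"
    using assms by (simp add: gauss_kernel_s_def gauss_kernel_ss_def field_simps power2_eq_square)
  finally show ?thesis by (simp add: gauss_kernel_s_def[abs_def])
qed

text \<open>This is the heat equation for the kernel: \<open>gauss_kernel_ss\<close> is also its
  second derivative in \<open>s\<close>.\<close>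

lemma DERIV_gauss_kernel_t:
  assumes "t > 0"
  shows "((\<lambda>t. gauss_kernel t s) has_real_derivative gauss_kernel_ss t s) (at t)"
proof -
  have D1: "((\<lambda>t. exp (- (s\<^sup>2 / (4 * t)))) has_real_derivative (s\<^sup>2 / (4 * t\<^sup>2)) * exp (- (s\<^sup>2 / (4 * t)))) (at t)"
    using assms by (auto intro!: derivative_eq_intros simp: field_simps power2_eq_square)
  have D2: "((\<lambda>t. sqrt (4 * pi * t)) has_real_derivative sqrt (4 * pi * t) / (2 * t)) (at t)"
  proof -
    have "((\<lambda>t. sqrt (4 * pi * t)) has_real_derivative (4 * pi) * (inverse (sqrt (4 * pi * t)) / 2)) (at t)"
      using mult_pos_pos[OF pi_gt_zero assms] by (auto intro!: derivative_eq_intros)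
    also have "(4 * pi) * (inverse (sqrt (4 * pi * t)) / 2) = sqrt (4 * pi * t) / (2 * t)"
      using assms real_sqrt_mult_self[of "4 * pi * t"] by (simp add: field_simps)
    finally show ?thesis .
  qed
  have nz: "sqrt (4 * pi * t) \<noteq> 0" using assms by simp
  have "(s\<^sup>2 / (4 * t\<^sup>2) * E * r - E * (r / (2 * t))) / (r * r) = (s\<^sup>2 / (4 * t\<^sup>2) - 1 / (2 * t)) * (E / r)"
    if "r \<noteq> 0" for E r :: real
    using that assms by (simp add: field_simps)
  from this[OF nz] show ?thesis
    using DERIV_divide[OF D1 D2 nz] unfolding gauss_kernel_def[abs_def] gauss_kernel_ss_def by simp
qed

text \<open>Passes to an integral over a compact interval, to which the Leibniz rule and the
  fundamental theorem of calculus apply.\<close>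

lemma heat_eq_integral:
  assumes t: "t > 0" and \<phi>: "\<phi> \<in> supported_in {-R..R}"
  shows "heat t \<phi> = integral {-R..R} (\<lambda>s. gauss_kernel t s * tf_apply \<phi> s)"
proof -
  have "heat t \<phi> = integral UNIV (\<lambda>s. gauss_kernel t s * tf_apply \<phi> s)"
    using t has_integral_integral_lborel[OF integrable_gauss_kernel_mult[OF t, of \<phi>]]
    by (simp add: heat_def integral_unique)
  also have "\<dots> = integral UNIV (\<lambda>s. if s \<in> {-R..R} then gauss_kernel t s * tf_apply \<phi> s else 0)"
    using \<phi> by (intro integral_cong) (auto simp: supported_in_iff)
  also have "\<dots> = integral {-R..R} (\<lambda>s. gauss_kernel t s * tf_apply \<phi> s)"
    by (rule integral_restrict_UNIV)
  finally show ?thesis .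
qed

lemma continuous_on_gauss_kernel: "t > 0 \<Longrightarrow> continuous_on S (gauss_kernel t)"
  using DERIV_gauss_kernel_s by (intro continuous_at_imp_continuous_on ballI DERIV_isCont) blast

text \<open>Differentiation under the integral acts on the kernel, the heat equation makes it a
  second space derivative, and two integrations by parts move that to \<open>\<phi>\<close>.\<close>

lemma DERIV_heat_pos:
  assumes t: "t > 0"
  shows "((\<lambda>t. heat t \<phi>) has_real_derivative heat t (tf_D (tf_D \<phi>))) (at t)"
proof -
  obtain R where R: "R > 0" "\<phi> \<in> supported_in {-R..R}" using supported_in_interval .
  \<comment> \<open>Strictly larger than \<open>R\<close>, so that \<open>\<phi>\<close> and its
    derivatives vanish at the end points.\<close>
  define R' where "R' = R + 1"
  have R': "\<phi> \<in> supported_in {-R'..R'}" "-R' \<le> R'"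
    using supported_in_mono[OF R(2)] R(1) by (auto simp: R'_def)
  have van: "tf_deriv k \<phi> x = 0" if "\<bar>x\<bar> = R'" for k x
    using that R by (intro tf_deriv_eq_0[of \<phi> "{-R..R}"]) (auto simp: R'_def)
  have cont: "continuous_on ({0<..} \<times> cbox (-R') R') (\<lambda>(t, s). gauss_kernel_ss t s * tf_apply \<phi> s)"
  proof -
    have "continuous_on ({0<..} \<times> cbox (-R') R') (\<lambda>z. tf_deriv 0 \<phi> (snd z))"
      by (intro continuous_on_compose2[OF tf_deriv_continuous[of UNIV]] continuous_intros) auto
    then show ?thesis
      unfolding gauss_kernel_ss_def gauss_kernel_def case_prod_unfold
      by (intro continuous_intros) auto
  qed
  have "((\<lambda>t. integral (cbox (-R') R') (\<lambda>s. gauss_kernel t s * tf_apply \<phi> s)) has_real_derivative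
      integral (cbox (-R') R') (\<lambda>s. gauss_kernel_ss t s * tf_apply \<phi> s)) (at t within {0<..})"
  proof (rule leibniz_rule_field_derivative[OF _ _ cont])
    show "((\<lambda>t. gauss_kernel t s * tf_apply \<phi> s) has_real_derivative gauss_kernel_ss t s * tf_apply \<phi> s)
        (at t within {0<..})" if "t \<in> {0<..}" for t s
      using that by (intro DERIV_cmult_right DERIV_subset[OF DERIV_gauss_kernel_t]) auto
    show "(\<lambda>s. gauss_kernel t s * tf_apply \<phi> s) integrable_on cbox (-R') R'" if "t \<in> {0<..}" for t
      using that tf_deriv_continuous[of _ 0 \<phi>]
      by (intro integrable_continuous continuous_on_mult continuous_on_gauss_kernel) auto
  qed (use t in auto)
  then have "((\<lambda>t. integral {-R'..R'} (\<lambda>s. gauss_kernel t s * tf_apply \<phi> s)) has_real_derivative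
      integral {-R'..R'} (\<lambda>s. gauss_kernel_ss t s * tf_apply \<phi> s)) (at t)"
    using t by (simp add: at_within_open[of t "{0<..}"])
  moreover have "eventually (\<lambda>t. heat t \<phi> = integral {-R'..R'} (\<lambda>s. gauss_kernel t s * tf_apply \<phi> s)) (nhds t)"
    by (rule eventually_mono[OF eventually_nhds_in_open[of "{0<..}" t]])
      (use t heat_eq_integral[OF _ R'(1)] in auto)
  ultimately have D: "((\<lambda>t. heat t \<phi>) has_real_derivative
      integral {-R'..R'} (\<lambda>s. gauss_kernel_ss t s * tf_apply \<phi> s)) (at t)"
    by (rule DERIV_ev)
  \<comment> \<open>Both integrations by parts at once: in the derivative of the antiderivative used
    here the two mixed terms cancel.\<close>
  have "((\<lambda>s. gauss_kernel_ss t s * tf_apply \<phi> s - gauss_kernel t s * tf_deriv 2 \<phi> s) has_integral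
      (gauss_kernel_s t R' * tf_apply \<phi> R' - gauss_kernel t R' * tf_deriv 1 \<phi> R') -
      (gauss_kernel_s t (-R') * tf_apply \<phi> (-R') - gauss_kernel t (-R') * tf_deriv 1 \<phi> (-R'))) {-R'..R'}"
  proof (rule fundamental_theorem_of_calculus[OF R'(2)])
    fix s
    have "((\<lambda>s. gauss_kernel_s t s * tf_apply \<phi> s - gauss_kernel t s * tf_deriv 1 \<phi> s) has_real_derivative
        (gauss_kernel_ss t s * tf_apply \<phi> s + tf_deriv 1 \<phi> s * gauss_kernel_s t s) -
        (gauss_kernel_s t s * tf_deriv 1 \<phi> s + tf_deriv 2 \<phi> s * gauss_kernel t s)) (at s)"
      using DERIV_gauss_kernel_s[OF t] DERIV_gauss_kernel_ss[OF t] tf_deriv_DERIV[of 0 \<phi>] tf_deriv_DERIV[of 1 \<phi>]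
      by (intro DERIV_diff DERIV_mult) (simp_all add: numeral_2_eq_2)
    also have "(gauss_kernel_ss t s * tf_apply \<phi> s + tf_deriv 1 \<phi> s * gauss_kernel_s t s) -
        (gauss_kernel_s t s * tf_deriv 1 \<phi> s + tf_deriv 2 \<phi> s * gauss_kernel t s) =
        gauss_kernel_ss t s * tf_apply \<phi> s - gauss_kernel t s * tf_deriv 2 \<phi> s"
      by (simp add: algebra_simps)
    finally show "((\<lambda>s. gauss_kernel_s t s * tf_apply \<phi> s - gauss_kernel t s * tf_deriv 1 \<phi> s) has_vector_derivative
        gauss_kernel_ss t s * tf_apply \<phi> s - gauss_kernel t s * tf_deriv 2 \<phi> s) (at s within {-R'..R'})"
      unfolding has_real_derivative_iff_has_vector_derivative [symmetric]
      by (rule has_field_derivative_at_within)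
  qed
  moreover have "tf_deriv k \<phi> R' = 0" "tf_deriv k \<phi> (-R') = 0" for k
    using van R' by auto
  note this[of 0] this[of 1]
  ultimately have I: "((\<lambda>s. gauss_kernel_ss t s * tf_apply \<phi> s - gauss_kernel t s * tf_deriv 2 \<phi> s) has_integral 0) {-R'..R'}"
    by simp
  have c2: "continuous_on {-R'..R'} (\<lambda>s. gauss_kernel t s * tf_deriv 2 \<phi> s)"
    using t tf_deriv_continuous[of _ 2 \<phi>] by (intro continuous_on_mult continuous_on_gauss_kernel)
  have "((\<lambda>s. (gauss_kernel_ss t s * tf_apply \<phi> s - gauss_kernel t s * tf_deriv 2 \<phi> s) + gauss_kernel t s * tf_deriv 2 \<phi> s)
      has_integral 0 + integral {-R'..R'} (\<lambda>s. gauss_kernel t s * tf_deriv 2 \<phi> s)) {-R'..R'}"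
    using I integrable_integral[OF integrable_continuous_interval[OF c2]] by (rule has_integral_add)
  then have "integral {-R'..R'} (\<lambda>s. gauss_kernel_ss t s * tf_apply \<phi> s) =
      integral {-R'..R'} (\<lambda>s. gauss_kernel t s * tf_deriv 2 \<phi> s)"
    by (simp add: integral_unique)
  also have "\<dots> = heat t (tf_D (tf_D \<phi>))"
    using heat_eq_integral[OF t supported_in_tf_D[OF supported_in_tf_D[OF R'(1)]]]
    by (simp add: tf_D.rep_eq numeral_2_eq_2)
  finally show ?thesis using D by simp
qed

section \<open>Continuity and differentiability up to time zero\<close>

lemma continuous_on_heat: "continuous_on {0..} (\<lambda>t. heat t \<phi>)"
  unfolding continuous_on_eq_continuous_within
proof
  fix t :: real assume "t \<in> {0..}"
  show "continuous (at t within {0..}) (\<lambda>t. heat t \<phi>)"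
  proof (cases "t = 0")
    case False
    then show ?thesis
      using \<open>t \<in> {0..}\<close> DERIV_isCont[OF DERIV_heat_pos[of t \<phi>]] continuous_at_imp_continuous_at_within by auto
  next
    case True
    obtain L where L: "\<And>s. \<bar>tf_deriv 1 \<phi> s\<bar> \<le> L" using tf_deriv_bounded by blast
    have "((\<lambda>t. heat t \<phi> - heat 0 \<phi>) \<longlongrightarrow> 0) (at 0 within {0..})"
    proof (rule Lim_null_comparison)
      show "eventually (\<lambda>t. norm (heat t \<phi> - heat 0 \<phi>) \<le> 3 * L * sqrt t) (at 0 within {0..})"
        unfolding eventually_at_filter
      proof (rule always_eventually, safe)
        fix t :: real assume "t \<noteq> 0" "t \<ge> 0"
        then show "norm (heat t \<phi> - heat 0 \<phi>) \<le> 3 * L * sqrt t"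
          using heat_sub_initial_le[of t \<phi> L, OF _ L] by simp
      qed
      show "((\<lambda>t. 3 * L * sqrt t) \<longlongrightarrow> 0) (at 0 within {0..})"
        by (rule tendsto_eq_intros refl | simp)+
    qed
    then show ?thesis unfolding True continuous_within by (simp add: Lim_null[symmetric])
  qed
qed

text \<open>At zero the mean value theorem equates the difference quotient with
  \<open>heat z (tf_D (tf_D \<phi>))\<close> at some intermediate time \<open>z\<close>, and this
  converges by continuity at zero.\<close>

lemma DERIV_heat:
  assumes "t \<ge> 0"
  shows "((\<lambda>t. heat t \<phi>) has_real_derivative heat t (tf_D (tf_D \<phi>))) (at t within {0..})"
proof (cases "t = 0")
  case False
  then have "t > 0" using assms by simp
  from DERIV_heat_pos[OF this] show ?thesis by (rule has_field_derivative_at_within)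
next
  case True
  let ?h = "\<lambda>t. heat t (tf_D (tf_D \<phi>))"
  have lim: "(?h \<longlongrightarrow> ?h 0) (at 0 within {0..})"
    using continuous_on_heat[of "tf_D (tf_D \<phi>)"] unfolding continuous_on by simp
  have "((\<lambda>x. (heat x \<phi> - heat 0 \<phi>) / (x - 0)) \<longlongrightarrow> ?h 0) (at 0 within {0..})"
  proof (rule tendstoI)
    fix e :: real assume "e > 0"
    then obtain d where d: "d > 0" "\<And>y. y \<in> {0..} \<Longrightarrow> y \<noteq> 0 \<Longrightarrow> \<bar>y\<bar> < d \<Longrightarrow> dist (?h y) (?h 0) < e"
      using tendstoD[OF lim \<open>e > 0\<close>] unfolding eventually_at by (auto simp: dist_real_def)
    have "dist ((heat x \<phi> - heat 0 \<phi>) / (x - 0)) (?h 0) < e" if x: "x \<in> {0..}" "x \<noteq> 0" "\<bar>x\<bar> < d" for x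
    proof -
      have "\<exists>l z. 0 < z \<and> z < x \<and> ((\<lambda>t. heat t \<phi>) has_real_derivative l) (at z) \<and> heat x \<phi> - heat 0 \<phi> = (x - 0) * l"
      proof (rule MVT)
        show "continuous_on {0..x} (\<lambda>t. heat t \<phi>)"
          by (rule continuous_on_subset[OF continuous_on_heat]) auto
        show "(\<lambda>t. heat t \<phi>) differentiable (at z)" if "0 < z" for z
          using DERIV_heat_pos[OF that] real_differentiable_def by blast
      qed (use x in auto)
      then obtain l z where z: "0 < z" "z < x" "((\<lambda>t. heat t \<phi>) has_real_derivative l) (at z)"
        "heat x \<phi> - heat 0 \<phi> = (x - 0) * l" by blast
      then have "l = ?h z" using DERIV_unique DERIV_heat_pos by blast
      then have "(heat x \<phi> - heat 0 \<phi>) / (x - 0) = ?h z" using z x by simp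
      then show ?thesis using d(2)[of z] z x by simp
    qed
    then show "eventually (\<lambda>x. dist ((heat x \<phi> - heat 0 \<phi>) / (x - 0)) (?h 0) < e) (at 0 within {0..})"
      unfolding eventually_at using d(1) by (intro exI[of _ d]) (auto simp: dist_real_def)
  qed
  then show ?thesis by (simp only: True has_field_derivative_iff)
qed

section \<open>Smoothness of the heat kernel along plots\<close>

lemma smooth_fun_partial_deriv: "smooth_fun n U f \<Longrightarrow> i < n \<Longrightarrow> smooth_fun n U (partial_deriv i f)"
  unfolding smooth_fun_def by (metis Ck_on.simps(2))

lemma smooth_fun_continuous: "smooth_fun n U f \<Longrightarrow> continuous_on U f"
  unfolding smooth_fun_def using Ck_on_continuous by blast

lemma smooth_fun_DERIV:
  assumes "smooth_fun n U f" "i < n" "x(i := a) \<in> U"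
  shows "((\<lambda>h. f (x(i := h))) has_real_derivative partial_deriv i f (x(i := a))) (at a)"
proof -
  have "Ck_on (Suc 0) n U f" using assms(1) by (simp only: smooth_fun_def)
  then have "(\<lambda>h. f ((x(i := a))(i := h))) differentiable (at ((x(i := a)) i))"
    using assms(2,3) unfolding Ck_on.simps by blast
  then have "((\<lambda>h. f ((x(i := a))(i := h))) has_real_derivative partial_deriv i f (x(i := a))) (at ((x(i := a)) i))"
    unfolding pd_deriv .
  then show ?thesis by simp
qed

text \<open>Two uses of the mean value inequality: the bound on \<open>f2\<close> makes
  \<open>f1 h - f1 a\<close> at most \<open>M * \<bar>u\<bar>\<close> in absolute value, and this
  difference is the derivative of \<open>f x - x * f1 a\<close> at \<open>h\<close>.\<close>

lemma second_order_remainder: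
  fixes f :: "real \<Rightarrow> real"
  assumes f: "\<And>h. h \<in> {a - \<delta>..a + \<delta>} \<Longrightarrow> (f has_real_derivative f1 h) (at h)"
    and f1: "\<And>h. h \<in> {a - \<delta>..a + \<delta>} \<Longrightarrow> (f1 has_real_derivative f2 h) (at h)"
    and f2: "continuous_on {a - \<delta>..a + \<delta>} f2"
  shows "\<exists>M. \<forall>u. \<bar>u\<bar> \<le> \<delta> \<longrightarrow> \<bar>f (a + u) - f a - u * f1 a\<bar> \<le> M * u\<^sup>2"
proof -
  have "compact (f2 ` {a - \<delta>..a + \<delta>})" using f2 by (intro compact_continuous_image) auto
  then obtain M where M: "\<And>h. h \<in> {a - \<delta>..a + \<delta>} \<Longrightarrow> \<bar>f2 h\<bar> \<le> M"
    using compact_imp_bounded bounded_iff by (metis image_eqI real_norm_def)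
  have "\<bar>f (a + u) - f a - u * f1 a\<bar> \<le> M * u\<^sup>2" if u: "\<bar>u\<bar> \<le> \<delta>" for u
  proof -
    let ?S = "{a - \<bar>u\<bar>..a + \<bar>u\<bar>}"
    have S: "?S \<subseteq> {a - \<delta>..a + \<delta>}" using u by auto
    have M0: "M \<ge> 0" using M[of a] u by force
    have "\<bar>f1 h - f1 a\<bar> \<le> M * \<bar>u\<bar>" if h: "h \<in> ?S" for h
    proof -
      have "norm (f1 h - f1 a) \<le> M * norm (h - a)"
        by (rule field_differentiable_bound[of ?S f1 f2])
          (use S h M in \<open>auto intro!: has_field_derivative_at_within[OF f1]\<close>)
      also have "\<dots> \<le> M * \<bar>u\<bar>" using h M0 by (intro mult_left_mono) auto
      finally show ?thesis by simp
    qed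
    then have "norm ((f (a + u) - (a + u) * f1 a) - (f a - a * f1 a)) \<le> (M * \<bar>u\<bar>) * norm ((a + u) - a)"
    proof (intro field_differentiable_bound[of ?S _ "\<lambda>h. f1 h - f1 a"])
      fix h assume "h \<in> ?S"
      then have "(f has_real_derivative f1 h) (at h)" using S f by blast
      then have "((\<lambda>x. f x - x * f1 a) has_real_derivative f1 h - f1 a) (at h)"
        by (auto intro!: derivative_eq_intros)
      then show "((\<lambda>x. f x - x * f1 a) has_real_derivative f1 h - f1 a) (at h within ?S)"
        by (rule has_field_derivative_at_within)
    qed auto
    then show ?thesis by (simp add: algebra_simps power2_eq_square)
  qed
  then show ?thesis by blast
qed

text \<open>Along the coordinate line each \<open>T \<circ> p\<close> has a quadratic remainder, as
  \<open>weak_derivative\<close> requires. The values of all distributions at \<open>\<eta>\<close>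
  will show that \<open>\<eta>\<close> depends on \<open>v\<close> as a plot; the supremum estimate
  is what \<open>heat_le\<close> can use.\<close>

lemma plot_derivative:
  assumes p: "p \<in> plots test_fun_space m V" and i: "i < m" and v: "v \<in> V"
  obtains \<eta> \<delta> C where "\<delta> > 0" "\<And>T. T \<in> distributions \<Longrightarrow> T \<eta> = partial_deriv i (T \<circ> p) v"
    "\<And>u s. 0 < \<bar>u\<bar> \<Longrightarrow> \<bar>u\<bar> \<le> \<delta> \<Longrightarrow>
      \<bar>tf_deriv 0 ((1 / u) *\<^sub>R (p (v(i := v i + u)) - p v) - \<eta>) s\<bar> \<le> C * \<bar>u\<bar>"
proof -
  have V: "openin (Euclidean_space m) V" and sm: "\<And>T. T \<in> distributions \<Longrightarrow> smooth_fun m V (T \<circ> p)"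
    using p by (auto simp: test_fun_space_def)
  obtain d where d: "d > 0" "\<And>h. dist h (v i) < d \<Longrightarrow> v(i := h) \<in> V"
    using eventually_fun_upd[OF V v i] unfolding eventually_nhds_metric by blast
  define \<delta> where "\<delta> = d / 2"
  have \<delta>: "\<delta> > 0" using d(1) by (simp add: \<delta>_def)
  have inV: "v(i := h) \<in> V" if "h \<in> {v i - \<delta>..v i + \<delta>}" for h
    using that d(1) by (intro d(2)) (auto simp: \<delta>_def dist_real_def)
  define c where "c u = p (v(i := v i + u))" for u
  have c0: "c 0 = p v" by (simp add: c_def)
  have rem: "\<exists>M. \<forall>u. \<bar>u\<bar> \<le> \<delta> \<longrightarrow> \<bar>T (c u) - T (c 0) - u * partial_deriv i (T \<circ> p) v\<bar> \<le> M * u\<^sup>2"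
    if T: "T \<in> distributions" for T
  proof -
    let ?F = "T \<circ> p"
    have F: "smooth_fun m V ?F" "smooth_fun m V (partial_deriv i ?F)" "smooth_fun m V (partial_deriv i (partial_deriv i ?F))"
      using sm[OF T] i by (auto intro: smooth_fun_partial_deriv)
    have "continuous_on {v i - \<delta>..v i + \<delta>} (\<lambda>h. partial_deriv i (partial_deriv i ?F) (v(i := h)))"
    proof (rule continuous_on_compose2[OF smooth_fun_continuous[OF F(3)]])
      show "continuous_on {v i - \<delta>..v i + \<delta>} (\<lambda>h. v(i := h))"
      proof (rule continuous_on_coordinatewise_then_product)
        show "continuous_on {v i - \<delta>..v i + \<delta>} (\<lambda>h. (v(i := h)) j)" for j by (cases "j = i") auto
      qed
    qed (use inV in auto)
    then have "\<exists>M. \<forall>u. \<bar>u\<bar> \<le> \<delta> \<longrightarrow> \<bar>?F (v(i := v i + u)) - ?F (v(i := v i)) - u * partial_deriv i ?F (v(i := v i))\<bar> \<le> M * u\<^sup>2"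
      using smooth_fun_DERIV[OF F(1) i inV] smooth_fun_DERIV[OF F(2) i inV]
      by (intro second_order_remainder[where f = "\<lambda>h. ?F (v(i := h))"])
    then show ?thesis by (simp add: c_def)
  qed
  obtain \<eta> C where "\<And>T. T \<in> distributions \<Longrightarrow> T \<eta> = partial_deriv i (T \<circ> p) v"
    "\<And>u s. 0 < \<bar>u\<bar> \<Longrightarrow> \<bar>u\<bar> \<le> \<delta> \<Longrightarrow> \<bar>tf_deriv 0 ((1 / u) *\<^sub>R (c u - c 0) - \<eta>) s\<bar> \<le> C * \<bar>u\<bar>"
    using weak_derivative[where c = c and d = "\<lambda>T. partial_deriv i (T \<circ> p) v", OF \<delta> rem] by blast
  with \<delta> that show ?thesis unfolding c0 unfolding c_def by blast
qed

text \<open>The increment splits into a change of time at the fixed function \<open>c a\<close>,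
  treated by the chain rule, and \<open>heat (\<tau> h)\<close> of the quotient \<open>q h\<close>.
  The latter differs from \<open>heat (\<tau> h) \<eta>\<close> by an error that
  \<open>heat_le\<close> controls at every time.\<close>

lemma DERIV_heat_curve:
  fixes c :: "real \<Rightarrow> test_fun"
  assumes \<tau>: "(\<tau> has_real_derivative \<tau>') (at a)" "\<And>h. \<tau> h \<ge> 0"
    and \<delta>: "\<delta> > 0"
    and c: "\<And>u s. 0 < \<bar>u\<bar> \<Longrightarrow> \<bar>u\<bar> \<le> \<delta> \<Longrightarrow>
      \<bar>tf_deriv 0 ((1 / u) *\<^sub>R (c (a + u) - c a) - \<eta>) s\<bar> \<le> C * \<bar>u\<bar>"
  shows "((\<lambda>h. heat (\<tau> h) (c h)) has_real_derivative
    heat (\<tau> a) (tf_D (tf_D (c a))) * \<tau>' + heat (\<tau> a) \<eta>) (at a)"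
proof -
  define q where "q h = (1 / (h - a)) *\<^sub>R (c h - c a)" for h
  have near: "eventually (\<lambda>h. 0 < \<bar>h - a\<bar> \<and> \<bar>h - a\<bar> \<le> \<delta>) (at a)"
    unfolding eventually_at using \<delta> by (intro exI[of _ \<delta>]) (auto simp: dist_real_def)
  have lim1: "((\<lambda>h. heat (\<tau> h) (q h - \<eta>)) \<longlongrightarrow> 0) (at a)"
  proof (rule Lim_null_comparison)
    show "eventually (\<lambda>h. norm (heat (\<tau> h) (q h - \<eta>)) \<le> C * \<bar>h - a\<bar>) (at a)"
      using near
    proof eventually_elim
      case (elim h)
      then have "\<bar>tf_apply (q h - \<eta>) s\<bar> \<le> C * \<bar>h - a\<bar>" for s
        using c[of "h - a" s] by (simp add: q_def)
      then show ?case using heat_le[OF \<tau>(2)] by simp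
    qed
    show "((\<lambda>h. C * \<bar>h - a\<bar>) \<longlongrightarrow> 0) (at a)"
      by (rule tendsto_eq_intros refl | simp)+
  qed
  \<comment> \<open>If \<open>\<tau> a = 0\<close>, then \<open>DERIV_heat\<close> is one-sided; the
    chain rule for derivatives within the image of \<open>\<tau>\<close> accepts this, since
    \<open>\<tau>\<close> never becomes negative.\<close>
  have img: "range \<tau> \<subseteq> {0..}" using \<tau>(2) by auto
  have DH: "((\<lambda>h. heat (\<tau> h) \<phi>) has_real_derivative heat (\<tau> a) (tf_D (tf_D \<phi>)) * \<tau>') (at a)" for \<phi>
    using DERIV_image_chain[OF DERIV_subset[OF DERIV_heat[OF \<tau>(2)[of a], of \<phi>] img] \<tau>(1)]
    by (simp add: comp_def)
  have lim2: "((\<lambda>h. heat (\<tau> h) \<eta>) \<longlongrightarrow> heat (\<tau> a) \<eta>) (at a)"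
    using DERIV_isCont[OF DH] by (simp add: isCont_def)
  have lim3: "((\<lambda>h. (heat (\<tau> h) (c a) - heat (\<tau> a) (c a)) / (h - a)) \<longlongrightarrow> heat (\<tau> a) (tf_D (tf_D (c a))) * \<tau>') (at a)"
    using DH[of "c a"] unfolding has_field_derivative_iff .
  have "((\<lambda>h. (heat (\<tau> h) (c a) - heat (\<tau> a) (c a)) / (h - a) + (heat (\<tau> h) (q h - \<eta>) + heat (\<tau> h) \<eta>)) \<longlongrightarrow>
      heat (\<tau> a) (tf_D (tf_D (c a))) * \<tau>' + (0 + heat (\<tau> a) \<eta>)) (at a)"
    by (intro tendsto_add lim1 lim2 lim3)
  moreover have "(heat (\<tau> h) (c a) - heat (\<tau> a) (c a)) / (h - a) + (heat (\<tau> h) (q h - \<eta>) + heat (\<tau> h) \<eta>) =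
      (heat (\<tau> h) (c h) - heat (\<tau> a) (c a)) / (h - a)" for h
  proof -
    interpret linear "heat (\<tau> h)" by (rule linear_heat[OF \<tau>(2)])
    have "heat (\<tau> h) (q h - \<eta>) + heat (\<tau> h) \<eta> = (heat (\<tau> h) (c h) - heat (\<tau> h) (c a)) / (h - a)"
      by (simp add: q_def diff scale)
    then show ?thesis by (simp add: add_divide_distrib[symmetric])
  qed
  ultimately show ?thesis by (simp add: has_field_derivative_iff)
qed

text \<open>Along a convergent sequence the plot converges weakly, hence uniformly, and
  \<open>heat_le\<close> makes the effect vanish uniformly in time. What remains is continuity in
  time for the fixed function \<open>p v\<close>.\<close>

lemma continuous_on_heat_plot:
  assumes t: "continuous_on V t" "t \<in> V \<rightarrow> {0..}" and p: "p \<in> plots test_fun_space m V"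
  shows "continuous_on V (\<lambda>v. heat (t v) (p v))"
  unfolding continuous_on_sequentially
proof (intro allI ballI impI, elim conjE)
  fix x v assume v: "v \<in> V" and x: "\<forall>n. x n \<in> V" "x \<longlonglongrightarrow> v"
  have lim: "(\<lambda>n. f (x n)) \<longlonglongrightarrow> f v" if "continuous_on V f" for f :: "_ \<Rightarrow> real"
    using that v x unfolding continuous_on_sequentially comp_def by blast
  have "(\<lambda>n. T (p (x n))) \<longlonglongrightarrow> T (p v)" if "T \<in> distributions" for T
    using lim[of "T \<circ> p"] smooth_fun_continuous[of m V "T \<circ> p"] p that by (auto simp: test_fun_space_def)
  then have unif: "uniform_limit UNIV (\<lambda>n. tf_deriv 0 (p (x n))) (tf_deriv 0 (p v)) sequentially"
    by (rule weakly_convergent_imp_uniform_limit)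
  have tx: "t (x n) \<ge> 0" for n using t(2) x(1) by auto
  have "(\<lambda>n. heat (t (x n)) (p (x n) - p v)) \<longlonglongrightarrow> 0"
  proof (rule tendstoI)
    fix e :: real assume "e > 0"
    then have "eventually (\<lambda>n. \<forall>s\<in>UNIV. dist (tf_deriv 0 (p (x n)) s) (tf_deriv 0 (p v) s) < e / 2) sequentially"
      using uniform_limitD[OF unif, of "e / 2"] by simp
    then show "eventually (\<lambda>n. dist (heat (t (x n)) (p (x n) - p v)) 0 < e) sequentially"
    proof eventually_elim
      case (elim n)
      then have "\<bar>tf_apply (p (x n) - p v) s\<bar> \<le> e / 2" for s
        by (simp add: minus_test_fun.rep_eq dist_real_def less_imp_le)
      then have "\<bar>heat (t (x n)) (p (x n) - p v)\<bar> \<le> e / 2" by (rule heat_le[OF tx])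
      then show ?case using \<open>e > 0\<close> by simp
    qed
  qed
  moreover have "(\<lambda>n. heat (t (x n)) (p v)) \<longlonglongrightarrow> heat (t v) (p v)"
    by (rule lim, rule continuous_on_compose2[OF continuous_on_heat t(1)]) (use t(2) in auto)
  ultimately have "(\<lambda>n. heat (t (x n)) (p (x n) - p v) + heat (t (x n)) (p v)) \<longlonglongrightarrow> 0 + heat (t v) (p v)"
    by (rule tendsto_add)
  moreover have "heat (t (x n)) (p (x n) - p v) + heat (t (x n)) (p v) = heat (t (x n)) (p (x n))" for n
    using linear_diff[OF linear_heat[OF tx[of n]]] by simp
  ultimately show "((\<lambda>v. heat (t v) (p v)) \<circ> x) \<longlonglongrightarrow> heat (t v) (p v)"
    by (simp add: comp_def)
qed

text \<open>\<open>p\<close> is arbitrary in the induction, because the derivative involves the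
  plots \<open>tf_D \<circ> (tf_D \<circ> p)\<close> and \<open>p' i\<close> in its place, with the
  same \<open>t\<close>.\<close>

lemma Ck_on_heat_plot:
  assumes t: "smooth_fun m V t" "t \<in> V \<rightarrow> {0..}"
  shows "p \<in> plots test_fun_space m V \<Longrightarrow> Ck_on k m V (\<lambda>v. heat (t v) (p v))"
proof (induction k arbitrary: p)
  case 0
  then show ?case using continuous_on_heat_plot[OF smooth_fun_continuous[OF t(1)] t(2)] by simp
next
  case (Suc k)
  note p = Suc.prems
  have V: "openin (Euclidean_space m) V" using p by (auto simp: test_fun_space_def)
  have "\<exists>\<eta> \<delta> C. \<delta> > 0 \<and> (\<forall>T\<in>distributions. T \<eta> = partial_deriv i (T \<circ> p) v) \<and>
      (\<forall>u s. 0 < \<bar>u\<bar> \<longrightarrow> \<bar>u\<bar> \<le> \<delta> \<longrightarrow> \<bar>tf_deriv 0 ((1 / u) *\<^sub>R (p (v(i := v i + u)) - p v) - \<eta>) s\<bar> \<le> C * \<bar>u\<bar>)"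
    if "i < m" "v \<in> V" for i v
    using plot_derivative[OF p that] by metis
  then obtain p' \<delta> C where \<delta>: "\<And>i v. i < m \<Longrightarrow> v \<in> V \<Longrightarrow> \<delta> i v > 0"
    and p': "\<And>i v T. i < m \<Longrightarrow> v \<in> V \<Longrightarrow> T \<in> distributions \<Longrightarrow> T (p' i v) = partial_deriv i (T \<circ> p) v"
    and est: "\<And>i v u s. i < m \<Longrightarrow> v \<in> V \<Longrightarrow> 0 < \<bar>u\<bar> \<Longrightarrow> \<bar>u\<bar> \<le> \<delta> i v \<Longrightarrow>
        \<bar>tf_deriv 0 ((1 / u) *\<^sub>R (p (v(i := v i + u)) - p v) - p' i v) s\<bar> \<le> C i v * \<bar>u\<bar>"
    by metis
  \<comment> \<open>Although \<open>p'\<close> is chosen point by point,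
    \<open>T \<circ> p' i\<close> agrees on \<open>V\<close> with a partial derivative of
    \<open>T \<circ> p\<close>.\<close>
  have p'_plot: "p' i \<in> plots test_fun_space m V" if i: "i < m" for i
  proof -
    have "smooth_fun m V (T \<circ> p' i)" if "T \<in> distributions" for T
    proof (rule smooth_fun_cong[OF V])
      show "smooth_fun m V (partial_deriv i (T \<circ> p))"
        using p that i by (auto simp: test_fun_space_def intro: smooth_fun_partial_deriv)
    qed (use p' i that in auto)
    with V show ?thesis by (simp add: test_fun_space_def)
  qed
  show ?case
  proof (rule Ck_on_SucI'[OF V, where D = "\<lambda>i v. heat (t v) ((tf_D \<circ> (tf_D \<circ> p)) v) * partial_deriv i t v + heat (t v) (p' i v)"])
    show "continuous_on V (\<lambda>v. heat (t v) (p v))"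
      by (rule continuous_on_heat_plot[OF smooth_fun_continuous[OF t(1)] t(2) p])
  next
    fix i assume i: "i < m"
    have "Ck_on k m V (partial_deriv i t)"
      using smooth_fun_partial_deriv[OF t(1) i] by (simp add: smooth_fun_def)
    then show "Ck_on k m V (\<lambda>v. heat (t v) ((tf_D \<circ> (tf_D \<circ> p)) v) * partial_deriv i t v + heat (t v) (p' i v))"
      using i by (intro Ck_on_add Ck_on_mult V Suc.IH tf_D_plot p p'_plot)
  next
    fix i v assume i: "i < m" and v: "v \<in> V"
    \<comment> \<open>\<open>DERIV_heat_curve\<close> asks for nonnegative times on the whole line.
      The value 0 where the coordinate line leaves \<open>V\<close> provides them and changes
      nothing near \<open>v i\<close>.\<close>
    define \<tau> where "\<tau> h = (if v(i := h) \<in> V then t (v(i := h)) else 0)" for h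
    have ev: "eventually (\<lambda>h. t (v(i := h)) = \<tau> h) (nhds (v i))"
      using eventually_fun_upd[OF V v i] by eventually_elim (simp add: \<tau>_def)
    have "((\<lambda>h. t (v(i := h))) has_real_derivative partial_deriv i t v) (at (v i))"
      using smooth_fun_DERIV[OF t(1) i, of v "v i"] v by simp
    then have "(\<tau> has_real_derivative partial_deriv i t v) (at (v i))"
      by (rule DERIV_ev) (use ev in \<open>auto elim: eventually_mono\<close>)
    moreover have "\<tau> h \<ge> 0" for h using t(2) by (auto simp: \<tau>_def)
    ultimately have "((\<lambda>h. heat (\<tau> h) (p (v(i := h)))) has_real_derivative
        heat (\<tau> (v i)) (tf_D (tf_D (p (v(i := v i))))) * partial_deriv i t v + heat (\<tau> (v i)) (p' i v)) (at (v i))"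
      by (rule DERIV_heat_curve[OF _ _ \<delta>[OF i v]]) (use est[OF i v] in simp)
    then have "((\<lambda>h. heat (t (v(i := h))) (p (v(i := h)))) has_real_derivative
        heat (\<tau> (v i)) (tf_D (tf_D (p (v(i := v i))))) * partial_deriv i t v + heat (\<tau> (v i)) (p' i v)) (at (v i))"
      by (rule DERIV_ev) (use ev in \<open>auto elim: eventually_mono\<close>)
    moreover have "\<tau> (v i) = t v" using v by (simp add: \<tau>_def)
    ultimately show "((\<lambda>h. heat (t (v(i := h))) (p (v(i := h)))) has_real_derivative
        heat (t v) ((tf_D \<circ> (tf_D \<circ> p)) v) * partial_deriv i t v + heat (t v) (p' i v)) (at (v i))"
      by simp
  qed
qed

theorem theorem4p2:
  fixes K :: "real \<Rightarrow> test_fun \<Rightarrow> real"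
  assumes "\<And>t \<phi>. t > 0 \<Longrightarrow>
      K t \<phi> = (LINT s|lborel. exp (- (s\<^sup>2 / (4 * t))) / sqrt (4 * pi * t) * tf_apply \<phi> s)"
    and "\<And>\<phi>. K 0 \<phi> = tf_apply \<phi> 0"
  shows "smooth_map nonneg_space distribution_space K"
  unfolding smooth_map_def
proof (intro conjI allI impI)
  \<comment> \<open>The assumptions determine \<open>K\<close> at nonnegative times, the only ones
    that a plot of \<open>nonneg_space\<close> takes on its domain.\<close>
  have K: "K t = heat t" if "t \<ge> 0" for t
    using that assms by (auto simp: heat_def gauss_kernel_def fun_eq_iff)
  then show "K \<in> points nonneg_space \<rightarrow> points distribution_space"
    using heat_distribution by (auto simp: nonneg_space_def induced_space_def distribution_space_def)
  fix n U p assume "p \<in> plots nonneg_space n U"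
  then have U: "openin (Euclidean_space n) U" and p: "smooth_fun n U p" "p \<in> U \<rightarrow> {0..}"
    by (auto simp: nonneg_space_def induced_space_def real_space_def)
  show "K \<circ> p \<in> plots distribution_space n U"
    unfolding distribution_plot_iff
  proof (intro conjI allI impI)
    show "K \<circ> p \<in> U \<rightarrow> distributions"
      using p(2) K heat_distribution by (auto simp: Pi_iff)
    fix m V f \<phi>
    assume V: "openin (Euclidean_space m) V" and f: "smooth_between m V n U f"
      and \<phi>: "\<phi> \<in> plots test_fun_space m V"
    have pf: "smooth_fun m V (p \<circ> f)" "p \<circ> f \<in> V \<rightarrow> {0..}"
      using smooth_fun_compose[OF V U f p(1)] f p(2) by (auto simp: smooth_between_def Pi_iff)
    show "smooth_fun m V (\<lambda>v. (K \<circ> p) (f v) (\<phi> v))"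
    proof (rule smooth_fun_cong[OF V])
      show "smooth_fun m V (\<lambda>v. heat ((p \<circ> f) v) (\<phi> v))"
        unfolding smooth_fun_def using Ck_on_heat_plot[OF pf \<phi>] by blast
    qed (use pf(2) K in \<open>auto simp: Pi_iff\<close>)
  qed (rule U)
qed

end
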